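(* Let $p_0,p_1,p_2\in R_{2,1}$ have no common zeros on $\mathbb{P}^1\times\mathbb{P}^1$, and let $I=\langle p_0,p_1,p_2\rangle\subset R$. In the generic case, the minimal (bigraded) free resolution of the ideal $I$ has the form $$0\to R(-6,-3)\to R(-4,-3)^3\oplus R(-6,-2)^2\to R(-6,-1)\oplus R(-4,-2)^3\oplus R(-3,-3)^2\to R(-2,-1)^3\to I\to 0.$$
   Context: $k$ is an algebraically closed field and $R=k[x,y,z,w]$ is bigraded with $x,y$ of degree $(1,0)$ and $z,w$ of degree $(0,1)$; $R_{m,n}$ is the graded piece of degree $(m,n)$ and $R(-a,-b)_{m,n}=R_{m-a,n-b}$. The variables $x,y$ (resp. $z,w$) are homogeneous coordinates on the first (resp. second) factor of $\mathbb{P}^1\times\mathbb{P}^1$. Generic case: identify $\mathbb{P}(R_{2,1})$ with $\mathbb{P}^5$. Since $p_0,p_1,p_2$ have no common zeros on $\mathbb{P}^1\times\mathbb{P}^1$ they are linearly independent, so $W(p)=\mathbb{P}(\mathrm{Span}(p_0,p_1,p_2))$ is a plane in $\mathbb{P}^5$. Let $Y\subset\mathbb{P}^5$ be the image of the Segre embedding $\mathbb{P}(R_{2,0})\times\mathbb{P}(R_{0,1})\to\mathbb{P}(R_{2,1})$ given by multiplication of polynomials. The case is generic if $W(p)\cap Y$ is finite, and non-generic if $W(p)\cap Y$ is infinite. *)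

theory Defs
  imports
    "HOL-Library.Poly_Mapping"
    "HOL-Library.Product_Plus"
    "HOL-Computational_Algebra.Polynomial"
    "Jordan_Normal_Form.Matrix_Kernel"
begin

section \<open>The bigraded polynomial ring\<close>

text \<open>The tuple \<open>(i, j, k, l)\<close> is the exponent vector of the monomial
  \<open>x^i y^j z^k w^l\<close>. Elements of \<open>R = k[x,y,z,w]\<close> are finitely supported
  coefficient functions on exponent vectors, with the convolution product of
  the theory \<open>Poly_Mapping\<close>.\<close>

type_synonym expo = "nat \<times> nat \<times> nat \<times> nat"
type_synonym 'k R = "expo \<Rightarrow>\<^sub>0 'k"

definition const :: "'k::comm_ring_1 \<Rightarrow> 'k R" where
  "const c = Poly_Mapping.single (0, 0, 0, 0) c"

definition var_x :: "'k::comm_ring_1 R" where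
  "var_x = Poly_Mapping.single (1, 0, 0, 0) 1"
definition var_y :: "'k::comm_ring_1 R" where
  "var_y = Poly_Mapping.single (0, 1, 0, 0) 1"
definition var_z :: "'k::comm_ring_1 R" where
  "var_z = Poly_Mapping.single (0, 0, 1, 0) 1"
definition var_w :: "'k::comm_ring_1 R" where
  "var_w = Poly_Mapping.single (0, 0, 0, 1) 1"

fun bidegree :: "expo \<Rightarrow> int \<times> int" where
  "bidegree (i, j, k, l) = (int (i + j), int (k + l))"

text \<open>The graded piece \<open>R_{m,n}\<close>; it is \<open>{0}\<close> if \<open>m < 0\<close> or \<open>n < 0\<close>.\<close>

definition R_piece :: "int \<Rightarrow> int \<Rightarrow> 'k::comm_ring_1 R set" where
  "R_piece m n = {f. \<forall>t\<in>Poly_Mapping.keys f. bidegree t = (m, n)}"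

definition eval_R :: "'k::comm_ring_1 R \<Rightarrow> 'k \<Rightarrow> 'k \<Rightarrow> 'k \<Rightarrow> 'k \<Rightarrow> 'k" where
  "eval_R f a b c d =
     (\<Sum>(i, j, k, l)\<in>Poly_Mapping.keys f. Poly_Mapping.lookup f (i, j, k, l) * a ^ i * b ^ j * c ^ k * d ^ l)"

text \<open>Points of \<open>P^1 \<times> P^1\<close> are given by homogeneous coordinates \<open>([a:b], [c:d])\<close>;
  vanishing of a bihomogeneous polynomial does not depend on the representative.\<close>

definition no_common_zeros :: "'k::comm_ring_1 R set \<Rightarrow> bool" where
  "no_common_zeros P \<longleftrightarrow>
     \<not> (\<exists>a b c d. (a, b) \<noteq> (0, 0) \<and> (c, d) \<noteq> (0, 0) \<and> (\<forall>f\<in>P. eval_R f a b c d = 0))"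

text \<open>The qualified names are needed because HOL-Algebra has a locale \<open>module\<close> as well.\<close>

abbreviation ideal_of :: "'k::comm_ring_1 R set \<Rightarrow> 'k R set" where
  "ideal_of \<equiv> Modules.module.span (*)"

abbreviation k_span :: "'k::comm_ring_1 R set \<Rightarrow> 'k R set" where
  "k_span \<equiv> Modules.module.span (\<lambda>c f. const c * f)"

lemma module_R_times: "Modules.module ((*) :: 'k::comm_ring_1 R \<Rightarrow> _)"
  by unfold_locales (simp_all add: algebra_simps)

lemma module_R_scale: "Modules.module (\<lambda>(c::'k::comm_ring_1) (f::'k R). const c * f)"
proof -
  have "const (a + b) = const a + (const b :: 'k R)" for a b
    by (simp add: const_def single_add)
  moreover have "const (a * b) = const a * (const b :: 'k R)" for a b
    by (simp add: const_def mult_single)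
  moreover have "const 1 = (1 :: 'k R)"
    by (simp add: const_def flip: single_one zero_prod_def)
  ultimately show ?thesis
    by unfold_locales (simp_all add: algebra_simps)
qed

section \<open>The generic case\<close>

text \<open>A point of \<open>P(V)\<close>, for a subspace \<open>V\<close> of \<open>R\<close>, is a line in \<open>V\<close> through the origin.\<close>

definition projectivization :: "'k::comm_ring_1 R set \<Rightarrow> 'k R set set" where
  "projectivization V = {k_span {f} | f. f \<in> V \<and> f \<noteq> 0}"

definition segre_image :: "'k::comm_ring_1 R set set" where
  "segre_image =
     {k_span {q * l} | q l. q \<in> R_piece 2 0 \<and> q \<noteq> 0 \<and> l \<in> R_piece 0 1 \<and> l \<noteq> 0}"

definition W_plane :: "'k::comm_ring_1 R \<Rightarrow> 'k R \<Rightarrow> 'k R \<Rightarrow> 'k R set set" where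
  "W_plane p0 p1 p2 = projectivization (k_span {p0, p1, p2})"

definition generic_case :: "'k::comm_ring_1 R \<Rightarrow> 'k R \<Rightarrow> 'k R \<Rightarrow> bool" where
  "generic_case p0 p1 p2 \<longleftrightarrow> finite (W_plane p0 p1 p2 \<inter> segre_image)"

section \<open>Minimal bigraded free resolutions\<close>

text \<open>A list \<open>[(c\<^sub>1,d\<^sub>1), \<dots>, (c\<^sub>r,d\<^sub>r)]\<close> of twists stands for the bigraded free module
  \<open>R(c\<^sub>1,d\<^sub>1) \<oplus> \<dots> \<oplus> R(c\<^sub>r,d\<^sub>r)\<close>, where \<open>R(c,d)_{m,n} = R_{m+c,n+d}\<close>. Its
  underlying set is \<open>carrier_vec r\<close>.\<close>

type_synonym twists = "(int \<times> int) list"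

definition free_piece :: "twists \<Rightarrow> int \<Rightarrow> int \<Rightarrow> 'k::comm_ring_1 R vec set" where
  "free_piece F m n =
     {v \<in> carrier_vec (length F).
        \<forall>i < length F. v $ i \<in> R_piece (m + fst (F ! i)) (n + snd (F ! i))}"

text \<open>An \<open>R\<close>-linear map between free modules is given by its matrix, acting on columns.\<close>

definition bigraded_hom :: "twists \<Rightarrow> twists \<Rightarrow> 'k::comm_ring_1 R mat \<Rightarrow> bool" where
  "bigraded_hom F G A \<longleftrightarrow>
     A \<in> carrier_mat (length G) (length F) \<and>
     (\<forall>m n. \<forall>v\<in>free_piece F m n. A *\<^sub>v v \<in> free_piece G m n)"

definition mat_image :: "'k::comm_ring_1 R mat \<Rightarrow> 'k R vec set" where
  "mat_image A = (\<lambda>v. A *\<^sub>v v) ` carrier_vec (dim_col A)"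

definition max_ideal :: "'k::comm_ring_1 R set" where
  "max_ideal = ideal_of {var_x, var_y, var_z, var_w}"

text \<open>\<open>0 \<rightarrow> F\<^sub>n \<rightarrow> \<dots> \<rightarrow> F\<^sub>1 \<rightarrow> F\<^sub>0 \<rightarrow> I \<rightarrow> 0\<close> is encoded by \<open>Fs = [F\<^sub>0, \<dots>, F\<^sub>n]\<close> and
  \<open>ds = [d\<^sub>0, \<dots>, d\<^sub>n]\<close>, where \<open>d\<^sub>0 : F\<^sub>0 \<rightarrow> I \<subseteq> R\<close> is the augmentation and
  \<open>d\<^sub>i : F\<^sub>i \<rightarrow> F\<^sub>i\<^sub>-\<^sub>1\<close> for \<open>i > 0\<close>. Minimality means that the image of \<open>d\<^sub>i\<^sub>+\<^sub>1\<close> lies in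
  \<open>(x,y,z,w) F\<^sub>i\<close>, which is the set of vectors with all entries in \<open>(x,y,z,w)\<close>.\<close>

definition bigraded_free_resolution ::
  "'k::comm_ring_1 R set \<Rightarrow> twists list \<Rightarrow> 'k R mat list \<Rightarrow> bool" where
  "bigraded_free_resolution I Fs ds \<longleftrightarrow>
     Fs \<noteq> [] \<and> length ds = length Fs \<and>
     bigraded_hom (Fs ! 0) [(0, 0)] (ds ! 0) \<and>
     (\<lambda>v. v $ 0) ` mat_image (ds ! 0) = I \<and>
     (\<forall>i. Suc i < length Fs \<longrightarrow>
        bigraded_hom (Fs ! Suc i) (Fs ! i) (ds ! Suc i) \<and>
        mat_image (ds ! Suc i) = mat_kernel (ds ! i)) \<and>
     mat_kernel (last ds) = {0\<^sub>v (length (last Fs))}"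

definition minimal_bigraded_free_resolution ::
  "'k::comm_ring_1 R set \<Rightarrow> twists list \<Rightarrow> 'k R mat list \<Rightarrow> bool" where
  "minimal_bigraded_free_resolution I Fs ds \<longleftrightarrow>
     bigraded_free_resolution I Fs ds \<and>
     (\<forall>i. Suc i < length Fs \<longrightarrow>
        (\<forall>v\<in>mat_image (ds ! Suc i). \<forall>j < length (Fs ! i). v $ j \<in> max_ideal))"

end

theory Submission
  imports Complex_Main Defs "HOL-Library.Product_Lexorder"
begin

text \<open>
  Write \<open>p\<^sub>j = z A\<^sub>j + w B\<^sub>j\<close> with \<open>A\<close>, \<open>B\<close> triples of quadrics in \<open>x, y\<close>, and \<open>p
      = (x\<^sup>2, xy, y\<^sup>2) r\<close>, where
  \<open>r\<close> is a \<open>3 \<times> 3\<close> matrix of linear forms in \<open>z, w\<close> with determinant \<open>D\<close>. A kernel vector of \<open>r\<close> at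
  a point \<open>(c, d)\<close> is an element of \<open>W(p)\<close> divisible by \<open>d z - c w\<close>, so the generic case means
  \<open>D \<noteq> 0\<close>. The resolution is explicit. The syzygies of \<open>p\<close> are \<open>s = A \<times> B\<close>, the Koszul syzygies
  \<open>p \<times> e\<^sub>i\<close>, and the adjugate of \<open>r\<close> applied to the two syzygies of \<open>(x\<^sup>2, xy, y\<^sup>2)\<close>.

  That these generate is shown by degree in \<open>x, y\<close>. A syzygy \<open>v\<close> of degree 1 or 2 becomes a
  combination of the generators after multiplication by \<open>D\<close> (Cramer's rule); \<open>D\<close> is a product of
  linear forms, and each of them can be cancelled because base point freeness keeps the generators
  independent at every point of the second factor. In degree at least 3, the equations
  \<open>A \<cdot> v = w g\<close> and \<open>B \<cdot> v = - z g\<close> hold with \<open>g\<close> in \<open>(x, y)\<^sup>5\<close>, which is contained in the ideal of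
  the three quartics \<open>s\<^sub>j\<close>; subtracting a Koszul syzygy leaves a vector killed by \<open>A\<close>
      and \<open>B\<close>, hence a
  multiple of \<open>s\<close>.
\<close>

section \<open>Substitution homomorphisms\<close>

text \<open>The lexicographic order makes exponent vectors a linearly ordered cancellative monoid,
  so that \<open>R\<close> over a field is an integral domain; the cancellations below rest on
  this.\<close>

instance prod :: ("{linorder,ordered_cancel_comm_monoid_add}",
    "{linorder,ordered_cancel_comm_monoid_add}") ordered_cancel_comm_monoid_add
  by standard (auto simp: less_eq_prod_def plus_prod_def add_left_mono add_strict_left_mono)

definition coeff_hom :: "('k::comm_ring_1 \<Rightarrow> 'b::comm_ring_1) \<Rightarrow> bool" where
  "coeff_hom h \<longleftrightarrow> h 0 = 0 \<and> h 1 = 1 \<and> (\<forall>a b. h (a + b) = h a + h b) \<and> (\<forall>a b. h (a * b) = h a * h b)"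

text \<open>For \<open>coeff_hom h\<close>, the ring homomorphism acting on coefficients by
  \<open>h\<close>. It is generic in \<open>h\<close> so that evaluation at a point, substitution
  inside \<open>R\<close> and the grading by a parameter are instances.\<close>

definition subst :: "('k::comm_ring_1 \<Rightarrow> 'b::comm_ring_1) \<Rightarrow> 'b \<Rightarrow> 'b \<Rightarrow> 'b \<Rightarrow> 'b \<Rightarrow> 'k R \<Rightarrow> 'b" where
  "subst h a b c d f =
     (\<Sum>(i, j, k, l)\<in>Poly_Mapping.keys f. h (Poly_Mapping.lookup f (i, j, k, l)) * a ^ i * b ^ j *
         c ^ k * d ^ l)"

lemma subst_eq_eval_R: "subst (\<lambda>c. c) a b c d f = eval_R f a b c d"
  by (simp add: eval_R_def subst_def)

lemma single_eq_monomial: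
  "Poly_Mapping.single (i, j, k, l) c = const c * var_x ^ i * var_y ^ j * var_z ^ k * var_w ^ l"
proof -
  have 1: "var_x ^ n = Poly_Mapping.single (n, 0, 0, 0) (1::'a)" for n
    by (induction n) (auto simp: var_x_def mult_single zero_prod_def simp flip: single_one)
  have 2: "var_y ^ n = Poly_Mapping.single (0, n, 0, 0) (1::'a)" for n
    by (induction n) (auto simp: var_y_def mult_single zero_prod_def simp flip: single_one)
  have 3: "var_z ^ n = Poly_Mapping.single (0, 0, n, 0) (1::'a)" for n
    by (induction n) (auto simp: var_z_def mult_single zero_prod_def simp flip: single_one)
  have 4: "var_w ^ n = Poly_Mapping.single (0, 0, 0, n) (1::'a)" for n
    by (induction n) (auto simp: var_w_def mult_single zero_prod_def simp flip: single_one)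
  show ?thesis unfolding 1 2 3 4 by (simp add: const_def mult_single)
qed

lemma sum_of_singles: "(\<Sum>t\<in>Poly_Mapping.keys f. Poly_Mapping.single t (Poly_Mapping.lookup f t))
    = f"
proof (rule poly_mapping_eqI)
  fix t
  show "Poly_Mapping.lookup (\<Sum>t\<in>Poly_Mapping.keys f. Poly_Mapping.single t (Poly_Mapping.lookup f
      t)) t = Poly_Mapping.lookup f t"
    by (cases "t \<in> Poly_Mapping.keys f") (auto simp: lookup_sum lookup_single when_def in_keys_iff)
qed

lemma const_0 [simp]: "const 0 = 0" by (simp add: const_def)
lemma const_1 [simp]: "const 1 = 1" by (simp add: const_def zero_prod_def flip: single_one)
lemma const_add: "const (a + b) = const a + const b" by (simp add: const_def single_add)
lemma const_mult: "const (a * b) = const a * const b" by (simp add: const_def mult_single)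
lemma const_uminus: "const (- a) = - const a" by (simp add: const_def single_uminus)
lemma const_diff: "const (a - b) = const a - const b" by (simp add: const_def single_diff)
lemma const_eq_0 [simp]: "const a = 0 \<longleftrightarrow> a = 0"
  by (metis const_def lookup_single_eq lookup_zero single_zero)

lemma R_sum_monomials:
  fixes f :: "'k::comm_ring_1 R"
  shows "f = (\<Sum>(i, j, k, l)\<in>Poly_Mapping.keys f. const (Poly_Mapping.lookup f (i, j, k, l)) *
      var_x ^ i * var_y ^ j * var_z ^ k * var_w ^ l)"
  by (subst sum_of_singles[symmetric]) (auto intro!: sum.cong simp: single_eq_monomial)

text \<open>Constants and variables generate \<open>R\<close> as a ring, so two homomorphisms on
  \<open>R\<close> need comparing on these generators only.\<close>

lemma R_induct [case_names const x y z w add mult]: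
  fixes f :: "'k::comm_ring_1 R"
  assumes c: "\<And>c. P (const c)" and "P var_x" "P var_y" "P var_z" "P var_w"
    and a: "\<And>f g. P f \<Longrightarrow> P g \<Longrightarrow> P (f + g)" and m: "\<And>f g. P f \<Longrightarrow> P g \<Longrightarrow> P (f * g)"
  shows "P f"
proof -
  have pow: "P (v ^ n)" if "P v" for v n
    by (induction n) (use c[of 1] m that in auto)
  have "P (const e * var_x ^ i * var_y ^ j * var_z ^ k * var_w ^ l)" for e i j k l
    by (intro m c pow assms)
  moreover have "P (sum g A)" if "finite A" "\<And>t. P (g t)" for g and A :: "expo set"
    using that by (induction A rule: finite_induct) (use c[of 0] a in auto)
  ultimately show ?thesis
    by (subst R_sum_monomials) (auto simp: case_prod_beta)
qed

context
  fixes h :: "'k::comm_ring_1 \<Rightarrow> 'b::comm_ring_1"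
  assumes h: "coeff_hom h"
begin

lemma subst_superset:
  assumes "finite S" "Poly_Mapping.keys f \<subseteq> S"
  shows "subst h a b c d f = (\<Sum>(i, j, k, l)\<in>S. h (Poly_Mapping.lookup f (i, j, k, l)) * a ^ i * b
      ^ j * c ^ k * d ^ l)"
  unfolding subst_def using assms h
  by (intro sum.mono_neutral_left) (auto simp: in_keys_iff coeff_hom_def)

lemma subst_add: "subst h a b c d (f + g) = subst h a b c d f + subst h a b c d g"
proof -
  let ?S = "Poly_Mapping.keys f \<union> Poly_Mapping.keys g"
  have "Poly_Mapping.keys (f + g) \<subseteq> ?S" by (rule Poly_Mapping.keys_add)
  then show ?thesis
    using h by (simp add: subst_superset[of ?S] lookup_add coeff_hom_def case_prod_beta
        distrib_right sum.distrib)
qed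

lemma subst_single: "subst h a b c d (Poly_Mapping.single (i, j, k, l) e)
    = h e * a ^ i * b ^ j * c ^ k * d ^ l"
  using h by (cases "e = 0") (auto simp: subst_def coeff_hom_def)

lemma subst_zero: "subst h a b c d 0 = 0"
  by (simp add: subst_def)

lemma subst_sum: "subst h a b c d (sum g A) = (\<Sum>t\<in>A. subst h a b c d (g t))"
  by (induction A rule: infinite_finite_induct) (auto simp: subst_add subst_zero)

lemma subst_mult: "subst h a b c d (f * g) = subst h a b c d f * subst h a b c d g"
proof -
  let ?s = "subst h a b c d"
  \<comment> \<open>Multiplicativity on single terms; bilinearity extends it to sums of
    terms.\<close>
  have *: "?s (Poly_Mapping.single t u * Poly_Mapping.single t' u') =
      ?s (Poly_Mapping.single t u) * ?s (Poly_Mapping.single t' u')" for t u t' u'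
    using h by (cases t; cases t') (simp add: mult_single subst_single power_add coeff_hom_def
        ac_simps)
  have "?s (f * g) = ?s ((\<Sum>t\<in>Poly_Mapping.keys f. Poly_Mapping.single t (Poly_Mapping.lookup f t)) *
      (\<Sum>t\<in>Poly_Mapping.keys g. Poly_Mapping.single t (Poly_Mapping.lookup g t)))"
    by (simp add: sum_of_singles)
  also have "\<dots> = ?s (\<Sum>t\<in>Poly_Mapping.keys f. Poly_Mapping.single t (Poly_Mapping.lookup f t)) *
      ?s (\<Sum>t\<in>Poly_Mapping.keys g. Poly_Mapping.single t (Poly_Mapping.lookup g t))"
    by (simp add: sum_product subst_sum *)
  finally show ?thesis by (simp add: sum_of_singles)
qed

lemma subst_const: "subst h a b c d (const e) = h e"
  by (simp add: const_def subst_single)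

lemma subst_one: "subst h a b c d 1 = 1"
  using subst_const[of a b c d 1] h by (simp add: coeff_hom_def)

lemma subst_uminus: "subst h a b c d (- f) = - subst h a b c d f"
  using subst_add[of a b c d f "- f"] by (simp add: subst_zero eq_neg_iff_add_eq_0 add.commute)

lemma subst_diff: "subst h a b c d (f - g) = subst h a b c d f - subst h a b c d g"
  using subst_add[of a b c d f "- g"] by (simp add: subst_uminus)

lemma subst_power: "subst h a b c d (f ^ n) = subst h a b c d f ^ n"
  by (induction n) (simp_all add: subst_one subst_mult)

lemma subst_vars:
  "subst h a b c d var_x = a" "subst h a b c d var_y = b" "subst h a b c d var_z = c"
      "subst h a b c d var_w = d"
  using h by (simp_all add: var_x_def var_y_def var_z_def var_w_def subst_single coeff_hom_def)

lemmas subst_simps = subst_add subst_zero subst_sum subst_mult subst_const subst_one subst_uminus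
  subst_diff subst_power subst_vars

end

lemma coeff_hom_id: "coeff_hom (\<lambda>c. c)" by (simp add: coeff_hom_def)
lemma coeff_hom_const: "coeff_hom const" by (simp add: coeff_hom_def const_add const_mult)
lemma coeff_hom_const_poly: "coeff_hom (\<lambda>c. [:const c:])"
  by (simp add: coeff_hom_def const_add const_mult)

lemmas eval_R_simps = subst_simps[OF coeff_hom_id, unfolded subst_eq_eval_R]
lemmas subst_const_simps = subst_simps[OF coeff_hom_const]

lemma subst_id: "subst const var_x var_y var_z var_w f = f"
  by (induction f rule: R_induct) (simp_all add: subst_const_simps)

lemma subst_subst:
  "subst const a b c d (subst const a' b' c' d' f) =
   subst const (subst const a b c d a') (subst const a b c d b') (subst const a b c d c') (subst
       const a b c d d') f"
  by (induction f rule: R_induct) (simp_all add: subst_const_simps)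

lemma subst_const_consts: "subst const (const a) (const b) (const c) (const d) f
    = const (eval_R f a b c d)"
  by (induction f rule: R_induct) (simp_all add: subst_const_simps eval_R_simps const_add
      const_mult)

text \<open>A substitution is the identity modulo the differences between variables and images. For
  a product this is the telescoping \<open>(f - ?s f) * g + ?s f * (g - ?s g)\<close>.\<close>

lemma diff_subst:
  "\<exists>q1 q2 q3 q4. f - subst const a b c d f = (var_x - a) * q1 + (var_y - b) * q2 + (var_z
      - c) * q3 + (var_w - d) * q4"
    (is "?P f")
proof (induction f rule: R_induct)
  case (const c)
  show ?case by (intro exI[of _ 0]) (simp add: subst_const_simps)
next
  case x show ?case by (rule exI[of _ 1], (rule exI[of _ 0])+) (simp add: subst_const_simps)
next
  case y show ?case by (rule exI[of _ 0], rule exI[of _ 1], (rule exI[of _ 0])+) (simp add: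
      subst_const_simps)
next
  case z show ?case by (rule exI[of _ 0], rule exI[of _ 0], rule exI[of _ 1], (rule exI[of _ 0])+)
      (simp add: subst_const_simps)
next
  case w show ?case by (rule exI[of _ 0], rule exI[of _ 0], rule exI[of _ 0], rule exI[of _ 1])
      (simp add: subst_const_simps)
next
  case (add f g)
  then obtain q1 q2 q3 q4 r1 r2 r3 r4 where
    f: "f - subst const a b c d f = (var_x - a) * q1 + (var_y - b) * q2 + (var_z - c) * q3
        + (var_w - d) * q4" and
    g: "g - subst const a b c d g = (var_x - a) * r1 + (var_y - b) * r2 + (var_z - c) * r3
        + (var_w - d) * r4"
    by blast
  have "f + g - subst const a b c d (f + g) = (f - subst const a b c d f) + (g
      - subst const a b c d g)"
    by (simp add: subst_const_simps)
  also have "\<dots> = (var_x - a) * (q1 + r1) + (var_y - b) * (q2 + r2) + (var_z - c) * (q3 + r3)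
      + (var_w - d) * (q4 + r4)"
    unfolding f g by (simp add: algebra_simps)
  finally show ?case by blast
next
  case (mult f g)
  let ?s = "subst const a b c d"
  obtain q1 q2 q3 q4 r1 r2 r3 r4 where
    f: "f - ?s f = (var_x - a) * q1 + (var_y - b) * q2 + (var_z - c) * q3 + (var_w - d) * q4" and
    g: "g - ?s g = (var_x - a) * r1 + (var_y - b) * r2 + (var_z - c) * r3 + (var_w - d) * r4"
    using mult by blast
  have "f * g - ?s (f * g) = (f - ?s f) * g + ?s f * (g - ?s g)"
    by (simp add: subst_const_simps algebra_simps)
  also have "\<dots> = (var_x - a) * (q1 * g + ?s f * r1) + (var_y - b) * (q2 * g + ?s f * r2) + (var_z
      - c) * (q3 * g + ?s f * r3) + (var_w - d) * (q4 * g + ?s f * r4)"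
    unfolding f g by (simp add: algebra_simps)
  finally show ?case by blast
qed

section \<open>The grading by the degree in x and y\<close>

text \<open>The polynomial \<open>f(xt, yt, z, w)\<close> in \<open>t\<close>.\<close>

definition x_grading :: "'k::comm_ring_1 R \<Rightarrow> 'k R poly" where
  "x_grading = subst (\<lambda>c. [:const c:]) [:0, var_x:] [:0, var_y:] [:var_z:] [:var_w:]"

lemmas x_grading_simps = subst_simps[OF coeff_hom_const_poly, where a = "[:0, var_x:]" and b =
    "[:0, var_y:]" and c = "[:var_z:]" and d = "[:var_w:]", folded x_grading_def]

lemma poly_x_grading_0: "poly (x_grading f) 0 = subst const 0 0 var_z var_w f"
  by (induction f rule: R_induct) (simp_all add: x_grading_simps subst_const_simps)

text \<open>The equation f(xt, yt, z, w) = t^d f; z and w may occur in any degree, and 0 is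
  homogeneous of every degree.\<close>

definition xhom :: "nat \<Rightarrow> 'k::comm_ring_1 R \<Rightarrow> bool" where
  "xhom d f \<longleftrightarrow> x_grading f = monom f d"

definition xpart :: "nat \<Rightarrow> 'k::comm_ring_1 R \<Rightarrow> 'k R" where
  "xpart d f = coeff (x_grading f) d"

lemma xhom_0 [simp]: "xhom d 0"
  by (simp add: xhom_def x_grading_simps)
lemma xhom_add: "xhom d f \<Longrightarrow> xhom d g \<Longrightarrow> xhom d (f + g)"
  by (simp add: xhom_def x_grading_simps add_monom)
lemma xhom_uminus: "xhom d f \<Longrightarrow> xhom d (- f)"
  by (simp add: xhom_def x_grading_simps minus_monom)
lemma xhom_diff: "xhom d f \<Longrightarrow> xhom d g \<Longrightarrow> xhom d (f - g)"
  by (simp add: xhom_def x_grading_simps diff_monom)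
lemma xhom_sum: "(\<And>i. i \<in> A \<Longrightarrow> xhom d (f i)) \<Longrightarrow> xhom d (sum f A)"
  by (induction A rule: infinite_finite_induct) (auto simp: xhom_add)
lemma xhom_mult: "xhom d f \<Longrightarrow> xhom e g \<Longrightarrow> d + e = n \<Longrightarrow> xhom n (f * g)"
  by (auto simp: xhom_def x_grading_simps mult_monom)
lemma xhom_power: "xhom d f \<Longrightarrow> d * m = n \<Longrightarrow> xhom n (f ^ m)"
  by (auto simp: xhom_def x_grading_simps monom_power mult.commute)
lemma xhom_const: "xhom 0 (const c)" by (simp add: xhom_def x_grading_simps monom_0)
lemma xhom_x: "xhom 1 var_x" by (simp add: xhom_def x_grading_simps monom_altdef)
lemma xhom_y: "xhom 1 var_y" by (simp add: xhom_def x_grading_simps monom_altdef)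
lemma xhom_z: "xhom 0 var_z" by (simp add: xhom_def x_grading_simps monom_0)
lemma xhom_w: "xhom 0 var_w" by (simp add: xhom_def x_grading_simps monom_0)

lemma xpart_add: "xpart d (f + g) = xpart d f + xpart d g" by (simp add: xpart_def x_grading_simps)
lemma xpart_diff: "xpart d (f - g) = xpart d f - xpart d g" by (simp add: xpart_def x_grading_simps)
lemma xpart_uminus: "xpart d (- f) = - xpart d f" by (simp add: xpart_def x_grading_simps)
lemma xpart_zero [simp]: "xpart d 0 = 0" by (simp add: xpart_def x_grading_simps)
lemma xpart_mult: "xhom e f \<Longrightarrow> xpart d (f * g) = (if e \<le> d then f * xpart (d - e) g else 0)"
  by (simp add: xpart_def xhom_def x_grading_simps coeff_monom_mult)
lemma xpart_xhom: "xhom e f \<Longrightarrow> xpart d f = (if d = e then f else 0)"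
  by (auto simp: xpart_def xhom_def)

text \<open>Monomials are homogeneous and \<open>xpart d\<close> is additive, so it collects the
  monomials of degree \<open>d\<close>.\<close>

lemma xhom_xpart: "xhom d (xpart d f)"
proof -
  have *: "xhom (i + j) (const c * var_x ^ i * var_y ^ j * var_z ^ k * var_w ^ l)" for c :: 'a
      and i j k l
    by (rule xhom_mult xhom_power xhom_const xhom_x xhom_y xhom_z xhom_w refl | simp)+
  have "xpart d f = (\<Sum>(i, j, k, l)\<in>Poly_Mapping.keys f. xpart d (const (Poly_Mapping.lookup f (i,
      j, k, l)) * var_x ^ i * var_y ^ j * var_z ^ k * var_w ^ l))"
    unfolding xpart_def by (subst R_sum_monomials) (simp add: x_grading_simps coeff_sum
        case_prod_beta)
  moreover have "xhom d (xpart d (const c * var_x ^ i * var_y ^ j * var_z ^ k * var_w ^ l))" for c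
      :: 'a and i j k l
    using *[of i j c k l] by (simp add: xpart_xhom[OF *])
  ultimately show ?thesis
    by (auto intro!: xhom_sum)
qed

lemma xpart_0: "xpart 0 f = subst const 0 0 var_z var_w f"
  by (simp add: xpart_def poly_0_coeff_0 flip: poly_x_grading_0)

lemma xhom_0_iff: "xhom 0 f \<longleftrightarrow> subst const 0 0 var_z var_w f = f"
  by (metis xhom_xpart xpart_0 xpart_xhom)

lemma xhom_0_subst:
  assumes "xhom 0 f"
  shows "subst const a b c d f = subst const 0 0 c d f"
proof -
  have "subst const a b c d (subst const 0 0 var_z var_w f) = subst const 0 0 c d f"
    by (simp add: subst_subst subst_const_simps)
  then show ?thesis using assms by (simp add: xhom_0_iff)
qed

lemma xhom_0_subst_id: "xhom 0 f \<Longrightarrow> subst const a b var_z var_w f = f"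
  using xhom_0_subst[of f a b var_z var_w] by (simp add: xhom_0_iff)

lemma xhom_subst:
  assumes "xhom 0 f" "xhom 0 c" "xhom 0 d"
  shows "xhom 0 (subst const a b c d f)"
  using assms unfolding xhom_0_subst[OF assms(1), of a b c d] xhom_0_iff
  by (simp add: subst_subst subst_const_simps)

section \<open>Linear forms\<close>

text \<open>One form for each point of the projective line: \<open>v\<close> vanishes at [1:0] and
  \<open>u - const c * v\<close> at [c:1].\<close>

definition linear_forms :: "'k::comm_ring_1 R \<Rightarrow> 'k R \<Rightarrow> 'k R set" where
  "linear_forms u v = insert v {u - const c * v | c. True}"

lemma var_nonzero [simp]: "var_x \<noteq> (0::'k::field R)" "var_y \<noteq> (0::'k R)" "var_z \<noteq> (0::'k R)"
    "var_w \<noteq> (0::'k R)"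
  by (metis eval_R_simps(2,10) zero_neq_one)
     (metis eval_R_simps(2,11) zero_neq_one, metis eval_R_simps(2,12) zero_neq_one, metis
         eval_R_simps(2,13) zero_neq_one)

text \<open>The substitution kills \<open>l\<close> and, by \<open>diff_subst\<close>, changes
  \<open>f\<close> only by a multiple of \<open>l\<close>: it is restriction to the zero set of
  \<open>l\<close>.\<close>

lemma dvd_iff_subst_eq_0:
  assumes "subst const a b c d l = 0" "l dvd var_x - a" "l dvd var_y - b" "l dvd var_z - c"
      "l dvd var_w - d"
  shows "l dvd f \<longleftrightarrow> subst const a b c d f = 0"
proof
  assume "l dvd f"
  then show "subst const a b c d f = 0" using assms(1) by (auto simp: dvd_def subst_const_simps)
next
  assume "subst const a b c d f = 0"
  then obtain q1 q2 q3 q4 where "f = (var_x - a) * q1 + (var_y - b) * q2 + (var_z - c) * q3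
      + (var_w - d) * q4"
    using diff_subst[of f a b c d] by auto
  then show "l dvd f" using assms(2-5) by simp
qed

lemma linear_forms_zw_subst:
  fixes l :: "'k::field R"
  assumes "l \<in> linear_forms var_z var_w"
  obtains c d :: 'k and t where "(c, d) \<noteq> (0, 0)" "t \<noteq> 0" "xhom 0 t"
    "\<And>f. l dvd f \<longleftrightarrow> subst const var_x var_y (const c * t) (const d * t) f = 0"
proof -
  consider "l = var_w" | c where "l = var_z - const c * var_w"
    using assms by (auto simp: linear_forms_def)
  then show ?thesis
  proof cases
    case 1
    show ?thesis
      by (rule that[of 1 0 var_z], simp, simp, rule xhom_z, rule dvd_iff_subst_eq_0) (simp_all
          add: 1 subst_const_simps)
  next
    case 2
    show ?thesis
      by (rule that[of c 1 var_w], simp, simp, rule xhom_w, rule dvd_iff_subst_eq_0) (simp_all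
          add: 2 subst_const_simps)
  qed
qed

lemma linear_forms_xy_subst:
  fixes l :: "'k::field R"
  assumes "l \<in> linear_forms var_x var_y"
  obtains c d :: 'k and t where "(c, d) \<noteq> (0, 0)" "t \<noteq> 0"
    "\<And>f. l dvd f \<longleftrightarrow> subst const (const c * t) (const d * t) var_z var_w f = 0"
proof -
  consider "l = var_y" | c where "l = var_x - const c * var_y"
    using assms by (auto simp: linear_forms_def)
  then show ?thesis
  proof cases
    case 1
    show ?thesis
      by (rule that[of 1 0 var_x], simp, simp, rule dvd_iff_subst_eq_0) (simp_all add: 1
          subst_const_simps)
  next
    case 2
    show ?thesis
      by (rule that[of c 1 var_y], simp, simp, rule dvd_iff_subst_eq_0) (simp_all add: 2
          subst_const_simps)
  qed
qed

text \<open>The multiples of \<open>l\<close> are the kernel of a homomorphism into an integral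
  domain, so \<open>l\<close> is prime.\<close>

lemma linear_form_dvd_mult:
  fixes l :: "'k::field R"
  assumes "l \<in> linear_forms var_x var_y \<union> linear_forms var_z var_w"
  shows "l dvd f * g \<longleftrightarrow> l dvd f \<or> l dvd g"
  using assms by (elim UnE linear_forms_xy_subst linear_forms_zw_subst) (simp_all add:
      subst_const_simps)

lemma linear_form_nonzero:
  fixes l :: "'k::field R"
  assumes "l \<in> linear_forms var_x var_y \<union> linear_forms var_z var_w"
  shows "l \<noteq> 0"
proof
  assume "l = 0"
  have "\<not> l dvd 1"
    using assms by (elim UnE linear_forms_xy_subst linear_forms_zw_subst) (simp_all add:
        subst_const_simps)
  consider "0 = var_y + const 0 * (var_y :: 'k R)" | "0 = var_w + const 0 * (var_w :: 'k R)" | c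
      where "0 = var_x - const c * (var_y :: 'k R)" | c where "0 = var_z
      - const c * (var_w :: 'k R)"
    using assms unfolding \<open>l = 0\<close> linear_forms_def by fastforce
  then show False
  proof cases
    case (3 c)
    then have "eval_R 0 1 0 0 0 = eval_R (var_x - const c * var_y) 1 0 0 0" by simp
    then show False by (simp add: eval_R_simps)
  next
    case (4 c)
    then have "eval_R 0 0 0 1 0 = eval_R (var_z - const c * var_w) 0 0 1 0" by simp
    then show False by (simp add: eval_R_simps)
  qed auto
qed

lemma linear_form_zw_xhom: "l \<in> linear_forms var_z var_w \<Longrightarrow> xhom 0 l"
  by (auto simp: linear_forms_def intro!: xhom_diff xhom_w xhom_z xhom_mult[OF xhom_const])

lemma xhom_0_cancel:
  fixes l :: "'k::field R"
  assumes "xhom 0 l" "xhom 0 (l * a)" "l \<noteq> 0"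
  shows "xhom 0 a"
  using assms by (simp add: xhom_0_iff subst_const_simps)

section \<open>Factors and roots of binary forms over an algebraically closed field\<close>

inductive_set split_forms :: "'k::comm_ring_1 R set \<Rightarrow> 'k R set" for L where
  const: "c \<noteq> 0 \<Longrightarrow> const c \<in> split_forms L"
| mult: "l \<in> L \<Longrightarrow> f \<in> split_forms L \<Longrightarrow> l * f \<in> split_forms L"

text \<open>Here \<open>n\<close> is the formal degree. If \<open>q\<close> has smaller degree, the
  form has the factor \<open>v\<close>, a root at infinity; otherwise a root \<open>c\<close> of
  \<open>q\<close> gives the factor \<open>u - const c * v\<close>.\<close>

lemma binary_form_splits_aux:
  fixes q :: "'k::alg_closed_field poly"
  assumes "q \<noteq> 0" "degree q \<le> n"
  shows "(\<Sum>i\<le>n. const (coeff q i) * u ^ i * v ^ (n - i)) \<in> split_forms (linear_forms u v)"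
  using assms
proof (induction n arbitrary: q)
  case 0
  then have "coeff q 0 \<noteq> 0" using leading_coeff_0_iff[of q] by simp
  then show ?case by (simp add: split_forms.const)
next
  case (Suc n)
  show ?case
  proof (cases "degree q = Suc n")
    case False
    then have *: "degree q \<le> n" using Suc.prems by simp
    then have "coeff q (Suc n) = 0" by (simp add: coeff_eq_0)
    then have "(\<Sum>i\<le>Suc n. const (coeff q i) * u ^ i * v ^ (Suc n - i)) =
        v * (\<Sum>i\<le>n. const (coeff q i) * u ^ i * v ^ (n - i))"
      by (simp add: sum_distrib_left Suc_diff_le ac_simps)
    then show ?thesis
      using Suc.IH[OF Suc.prems(1) *] by (auto simp: linear_forms_def intro: split_forms.mult)
  next
    case True
    then obtain c where "poly q c = 0" using alg_closed_imp_poly_has_root[of q] by auto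
    then obtain r where r: "q = [:- c, 1:] * r" by (auto simp: poly_eq_0_iff_dvd dvd_def)
    have "r \<noteq> 0" using Suc.prems r by auto
    then have deg: "degree q = Suc (degree r)" unfolding r by (subst degree_mult_eq) auto
    have "(\<Sum>i\<le>Suc n. const (coeff q i) * u ^ i * v ^ (Suc n - i)) =
       (\<Sum>i\<le>Suc n. const (case i of 0 \<Rightarrow> 0 | Suc j \<Rightarrow> coeff r j) * u ^ i * v ^ (Suc n - i))
        - (\<Sum>i\<le>Suc n. const (c * coeff r i) * u ^ i * v ^ (Suc n - i))"
      unfolding sum_subtractf[symmetric]
      by (rule sum.cong) (auto simp: r coeff_pCons const_diff const_add const_uminus algebra_simps
          split: nat.split)
    also have "(\<Sum>i\<le>Suc n. const (case i of 0 \<Rightarrow> 0 | Suc j \<Rightarrow> coeff r j) * u ^ i * v ^ (Suc n - i)) =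
        u * (\<Sum>i\<le>n. const (coeff r i) * u ^ i * v ^ (n - i))"
      by (subst sum.atMost_Suc_shift) (simp add: sum_distrib_left ac_simps)
    also have "(\<Sum>i\<le>Suc n. const (c * coeff r i) * u ^ i * v ^ (Suc n - i)) =
        const c * v * (\<Sum>i\<le>n. const (coeff r i) * u ^ i * v ^ (n - i))"
      using deg True by (simp add: sum_distrib_left Suc_diff_le const_mult ac_simps coeff_eq_0)
    finally have "(\<Sum>i\<le>Suc n. const (coeff q i) * u ^ i * v ^ (Suc n - i)) =
        (u - const c * v) * (\<Sum>i\<le>n. const (coeff r i) * u ^ i * v ^ (n - i))"
      by (simp add: algebra_simps)
    then show ?thesis
      using Suc.IH[OF \<open>r \<noteq> 0\<close>] True deg by (auto simp: linear_forms_def intro: split_forms.mult)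
  qed
qed

lemma binary_form_splits:
  fixes e :: "nat \<Rightarrow> 'k::alg_closed_field"
  assumes "(\<Sum>i\<le>n. const (e i) * u ^ i * v ^ (n - i)) \<noteq> 0"
  shows "(\<Sum>i\<le>n. const (e i) * u ^ i * v ^ (n - i)) \<in> split_forms (linear_forms u v)"
proof -
  define q where "q = (\<Sum>i\<le>n. monom (e i) i)"
  have c: "coeff q i = e i" if "i \<le> n" for i
    using that by (simp add: q_def coeff_sum)
  have "degree q \<le> n"
    unfolding q_def by (intro degree_sum_le) (auto intro: degree_monom_le order_trans)
  moreover have "(\<Sum>i\<le>n. const (coeff q i) * u ^ i * v ^ (n - i))
      = (\<Sum>i\<le>n. const (e i) * u ^ i * v ^ (n - i))"
    by (rule sum.cong) (auto simp: c)
  moreover from this have "q \<noteq> 0" using assms by auto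
  ultimately show ?thesis using binary_form_splits_aux[of q n u v] by simp
qed

lemma binary_form_has_root:
  fixes e :: "nat \<Rightarrow> 'k::alg_closed_field"
  assumes "n > 0"
  shows "\<exists>a b. (a, b) \<noteq> (0, 0) \<and> (\<Sum>i\<le>n. e i * a ^ i * b ^ (n - i)) = 0"
proof (cases "e n = 0")
  case True
  have "(\<Sum>i\<le>n. e i * 1 ^ i * 0 ^ (n - i)) = (\<Sum>i\<in>{n}. e i)"
    by (rule sum.mono_neutral_cong_right) auto
  then show ?thesis using True by (intro exI[of _ 1] exI[of _ 0]) simp
next
  case False
  then obtain a where "(\<Sum>i\<le>n. e i * a ^ i) = 0" using alg_closed[of n e] assms by blast
  then show ?thesis by (intro exI[of _ a] exI[of _ 1]) simp
qed

text \<open>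
  The sets \<open>V\<close> of interest are spanned by vectors that stay independent at every point of a
  projective line; then no linear form on this line divides a combination nontrivially.
\<close>

definition saturated :: "'k::comm_ring_1 R set \<Rightarrow> ((nat \<Rightarrow> 'k R) \<Rightarrow> bool) \<Rightarrow> bool" where
  "saturated L V \<longleftrightarrow> (\<forall>c u. V u \<longrightarrow> V (\<lambda>i. const c * u i)) \<and> (\<forall>l\<in>L. \<forall>u. V (\<lambda>i. l * u i) \<longrightarrow> V u)"

lemma saturated_cancel:
  fixes f :: "'k::field R"
  assumes "saturated L V" "f \<in> split_forms L" "V (\<lambda>i. f * u i)"
  shows "V u"
  using assms(2,3)
proof (induction)
  case (const c)
  then have "V (\<lambda>i. const (inverse c) * (const c * u i))"
    using assms(1) by (simp add: saturated_def)
  then show ?case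
    using const by (simp add: mult.assoc[symmetric] const_mult[symmetric])
next
  case (mult l f)
  have "V (\<lambda>i. l * (f * u i))" using mult.prems by (simp add: mult.assoc)
  then show ?case using assms(1) mult by (simp add: saturated_def)
qed

section \<open>Divisibility and syzygies of monomials\<close>

text \<open>\<open>var_y\<close> is prime and does not divide \<open>var_x\<close>, so x and y have
  only Koszul syzygies.\<close>

lemma mult_x_eq_mult_y:
  fixes f g :: "'k::field R"
  assumes "var_x * f = var_y * g"
  obtains t where "f = var_y * t" "g = var_x * t"
proof -
  have *: "var_y \<in> linear_forms var_x (var_y :: 'k R)" by (simp add: linear_forms_def)
  have "\<not> var_y dvd (var_x :: 'k R)"
    using dvd_iff_subst_eq_0[of var_x 0 var_z var_w var_y "var_x :: 'k R"]
        by (simp add: subst_const_simps)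
  moreover have "var_y dvd var_x * f" using assms by simp
  ultimately obtain t where t: "f = var_y * t"
    using linear_form_dvd_mult[of "var_y :: 'k R"] * by (auto elim: dvdE)
  with assms have "var_y * (var_x * t) = var_y * g" by (simp add: ac_simps)
  then have "g = var_x * t" by simp
  with t that show ?thesis by blast
qed

lemma mult_w_eq_mult_z:
  fixes f g :: "'k::field R"
  assumes "var_w * f = var_z * g"
  obtains t where "f = var_z * t" "g = var_w * t"
proof -
  have *: "var_w \<in> linear_forms var_z (var_w :: 'k R)" by (simp add: linear_forms_def)
  have "\<not> var_w dvd (var_z :: 'k R)"
    using dvd_iff_subst_eq_0[of var_x var_y var_z 0 var_w "var_z :: 'k R"]
        by (simp add: subst_const_simps)
  moreover have "var_w dvd var_z * g" using assms by (metis dvd_triv_left)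
  ultimately obtain t where t: "g = var_w * t"
    using linear_form_dvd_mult[of "var_w :: 'k R"] * by (auto elim: dvdE)
  with assms have "var_w * (var_z * t) = var_w * f" by (simp add: ac_simps)
  then have "f = var_z * t" by simp
  with t that show ?thesis by blast
qed

text \<open>Repeated cancelling of x against y: the generators (y, -x, 0) and (0, y, -x) are those
  of the Hilbert-Burch theorem.\<close>

lemma quadrics_syzygy:
  fixes u0 u1 u2 :: "'k::field R"
  assumes "var_x ^ 2 * u0 + var_x * var_y * u1 + var_y ^ 2 * u2 = 0"
  obtains n1 n2 where "u0 = var_y * n1" "u1 = var_y * n2 - var_x * n1" "u2 = - (var_x * n2)"
proof -
  have "var_x * (var_x * u0) = var_y * (- (var_x * u1 + var_y * u2))"
    using assms by (simp add: power2_eq_square algebra_simps eq_neg_iff_add_eq_0)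
  then obtain t where t: "var_x * u0 = var_y * t" "- (var_x * u1 + var_y * u2) = var_x * t"
    by (rule mult_x_eq_mult_y)
  obtain n1 where n1: "u0 = var_y * n1" "t = var_x * n1"
    using t(1) by (rule mult_x_eq_mult_y)
  have "var_x * (u1 + var_x * n1) = - (var_x * u1 + var_y * u2) + var_x * u1"
    unfolding t(2) n1 by (simp add: algebra_simps)
  then have "var_x * (u1 + var_x * n1) = var_y * (- u2)"
    by simp
  then obtain n2 where "u1 + var_x * n1 = var_y * n2" "- u2 = var_x * n2"
    by (rule mult_x_eq_mult_y)
  then show ?thesis
    using n1 by (intro that[of n1 n2]) (simp_all add: eq_diff_eq minus_equation_iff[of u2])
qed

text \<open>Setting (x, y) to (1, 0) and to (0, 1) isolates the coefficients, which are free of x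
  and y.\<close>

lemma xhom_0_linear_eq_0:
  fixes f g :: "'k::field R"
  assumes "xhom 0 f" "xhom 0 g" "var_x * f + var_y * g = 0"
  shows "f = 0" "g = 0"
proof -
  have *: "subst const a b var_z var_w (var_x * f + var_y * g) = 0" for a b
    unfolding assms(3) by (simp add: subst_const_simps)
  show "f = 0" "g = 0"
    using *[of 1 0] *[of 0 1] by (simp_all add: subst_const_simps xhom_0_subst_id assms(1,2))
qed

lemma xhom_0_quadratic_eq_0:
  fixes f g h :: "'k::field R"
  assumes "xhom 0 f" "xhom 0 g" "xhom 0 h" "var_x ^ 2 * f + var_x * var_y * g + var_y ^ 2 * h = 0"
  shows "f = 0" "g = 0" "h = 0"
proof -
  have *: "subst const a b var_z var_w (var_x ^ 2 * f + var_x * var_y * g + var_y ^ 2 * h)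
      = 0" for a b
    unfolding assms(4) by (simp add: subst_const_simps)
  show fh: "f = 0" "h = 0"
    using *[of 1 0] *[of 0 1] by (simp_all add: subst_const_simps xhom_0_subst_id assms(1-3))
  show "g = 0" using assms(4) unfolding fh by simp
qed

text \<open>Restriction to the zero set of \<open>l\<close> fixes x and y and keeps the coefficients
  free of them, so they vanish separately.\<close>

lemma linear_form_dvd_linear:
  fixes f g :: "'k::field R"
  assumes "l \<in> linear_forms var_z var_w" "xhom 0 f" "xhom 0 g" "l dvd var_x * f + var_y * g"
  shows "l dvd f" "l dvd g"
proof -
  obtain c d t where *: "xhom 0 t"
    "\<And>f. l dvd f \<longleftrightarrow> subst const var_x var_y (const c * t) (const d * t) f = 0"
    using linear_forms_zw_subst[OF assms(1)] by metis
  have h: "xhom 0 (subst const var_x var_y (const c * t) (const d * t) f)" if "xhom 0 f" for f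
    using that by (intro xhom_subst xhom_mult[OF xhom_const *(1)]) auto
  show "l dvd f" "l dvd g"
    using xhom_0_linear_eq_0[OF h[OF assms(2)] h[OF assms(3)]] assms(4) unfolding *(2)
        by (simp_all add: subst_const_simps)
qed

lemma linear_form_dvd_quadratic:
  fixes f g :: "'k::field R"
  assumes "l \<in> linear_forms var_z var_w" "xhom 0 f" "xhom 0 g" "xhom 0 h" "l dvd var_x ^ 2 * f
      + var_x * var_y * g + var_y ^ 2 * h"
  shows "l dvd f" "l dvd g" "l dvd h"
proof -
  obtain c d t where *: "xhom 0 t"
    "\<And>f. l dvd f \<longleftrightarrow> subst const var_x var_y (const c * t) (const d * t) f = 0"
    using linear_forms_zw_subst[OF assms(1)] by metis
  have h: "xhom 0 (subst const var_x var_y (const c * t) (const d * t) f)" if "xhom 0 f" for f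
    using that by (intro xhom_subst xhom_mult[OF xhom_const *(1)]) auto
  show "l dvd f" "l dvd g" "l dvd h"
    using xhom_0_quadratic_eq_0[OF h[OF assms(2)] h[OF assms(3)] h[OF assms(4)]] assms(5)
        unfolding *(2) by (simp_all add: subst_const_simps)
qed

text \<open>\<open>J\<close> stands for membership in an ideal that contains (x, y)^n, hence every
  term of degree at least \<open>n\<close> in x and y. It is applied to (x, y) itself and to the
  ideal of the quartics \<open>s j\<close>.\<close>

lemma xy_power_ideal:
  fixes f :: "'k::comm_ring_1 R"
  assumes add: "\<And>f g. J f \<Longrightarrow> J g \<Longrightarrow> J (f + g)" and mult: "\<And>f g. J f \<Longrightarrow> J (f * g)"
    and gen: "\<And>i. i \<le> n \<Longrightarrow> J (var_x ^ i * var_y ^ (n - i))"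
  shows "J (f - (\<Sum>d<n. xpart d f))"
proof -
  let ?Q = "\<lambda>f. f - (\<Sum>d<n. xpart d f)"
  have J0: "J 0" using mult[OF gen[of 0], of 0] by simp
  have xh: "xhom (i + j) (const c * var_x ^ i * var_y ^ j * var_z ^ k * var_w ^ l)" for c :: 'k
      and i j k l
    by (rule xhom_mult xhom_power xhom_const xhom_x xhom_y xhom_z xhom_w refl | simp)+
  have mono: "J (?Q (const c * var_x ^ i * var_y ^ j * var_z ^ k * var_w ^ l))" for c i j k l
  proof (cases "i + j < n")
    case True
    let ?m = "const c * var_x ^ i * var_y ^ j * var_z ^ k * var_w ^ l"
    from True have "?Q ?m = 0" by (simp add: xpart_xhom[OF xh] sum.delta')
    then show ?thesis using J0 by simp
  next
    case False
    let ?m = "const c * var_x ^ i * var_y ^ j * var_z ^ k * var_w ^ l"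
    \<comment> \<open>\<open>x^a y^(n - a)\<close> has degree exactly \<open>n\<close> and divides
      the monomial because \<open>i + j\<close> is at least \<open>n\<close>.\<close>
    define a where "a = min i n"
    have "var_x ^ i * var_y ^ j = var_x ^ (a + (i - a)) * (var_y :: 'k R) ^ ((n - a) + (j - (n
        - a)))"
      using False by (simp add: a_def)
    then have "?m = (var_x ^ a * var_y ^ (n - a)) * (const c * var_x ^ (i - a) * var_y ^ (j - (n
        - a)) * var_z ^ k * var_w ^ l)"
      unfolding power_add by (simp only: ac_simps)
    then have "J ?m" using mult[OF gen[of a]] by (simp add: a_def)
    moreover have "(\<Sum>d<n. xpart d ?m) = 0" using False
        by (intro sum.neutral) (auto simp: xpart_xhom[OF xh])
    ultimately show ?thesis by simp
  qed
  have Qadd: "?Q (f + g) = ?Q f + ?Q g" for f g :: "'k R"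
    by (simp add: xpart_add sum.distrib)
  have Q0: "?Q 0 = 0" by simp
  have "J (?Q (sum g A))" if "finite A" "\<And>t. J (?Q (g t))" for g and A :: "expo set"
    using that by (induction A rule: finite_induct) (simp_all only: sum.empty sum.insert Q0 J0
        Qadd add not_False_eq_True)
  then show ?thesis
    by (subst (1 2) R_sum_monomials) (use mono in \<open>auto simp: case_prod_beta\<close>)
qed

section \<open>Bihomogeneous polynomials\<close>

lemma R_eq_sum_over:
  fixes f :: "'k::comm_ring_1 R"
  assumes "finite S" "Poly_Mapping.keys f \<subseteq> S"
  shows "f = (\<Sum>(i, j, k, l)\<in>S. const (Poly_Mapping.lookup f (i, j, k, l)) * var_x ^ i * var_y ^ j
      * var_z ^ k * var_w ^ l)"
  using subst_superset[OF coeff_hom_const assms, of var_x var_y var_z var_w] by (simp add: subst_id)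

lemma R_piece_binary:
  assumes "f \<in> R_piece (int n) 0"
  shows "f = (\<Sum>i\<le>n. const (Poly_Mapping.lookup f (i, n - i, 0, 0)) * var_x ^ i * var_y ^ (n - i))"
proof -
  have "Poly_Mapping.keys f \<subseteq> (\<lambda>i. (i, n - i, 0, 0)) ` {..n}"
    using assms by (force simp: R_piece_def)
  from R_eq_sum_over[OF _ this] have "f = (\<Sum>(i, j, k, l)\<in>(\<lambda>i. (i, n - i, 0, 0)) ` {..n}.
      const (Poly_Mapping.lookup f (i, j, k, l)) * var_x ^ i * var_y ^ j * var_z ^ k * var_w ^ l)"
          by simp
  then show ?thesis
    by (subst (asm) sum.reindex) (auto simp: inj_on_def)
qed

lemma R_piece_binary_zw:
  assumes "f \<in> R_piece 0 (int n)"
  shows "f = (\<Sum>i\<le>n. const (Poly_Mapping.lookup f (0, 0, i, n - i)) * var_z ^ i * var_w ^ (n - i))"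
proof -
  have "Poly_Mapping.keys f \<subseteq> (\<lambda>i. (0, 0, i, n - i)) ` {..n}"
    using assms by (force simp: R_piece_def)
  from R_eq_sum_over[OF _ this] have "f = (\<Sum>(i, j, k, l)\<in>(\<lambda>i. (0, 0, i, n - i)) ` {..n}.
      const (Poly_Mapping.lookup f (i, j, k, l)) * var_x ^ i * var_y ^ j * var_z ^ k * var_w ^ l)"
          by simp
  then show ?thesis
    by (subst (asm) sum.reindex) (auto simp: inj_on_def)
qed

lemma R_piece_2_1:
  assumes "f \<in> R_piece 2 1"
  shows "\<exists>e g. f = var_z * (var_x ^ 2 * const (e 0) + var_x * var_y * const (e 1)
      + var_y ^ 2 * const (e (2::nat))) +
         var_w * (var_x ^ 2 * const (g 0) + var_x * var_y * const (g 1)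
             + var_y ^ 2 * const (g (2::nat)))"
proof -
  have keys: "Poly_Mapping.keys f \<subseteq> {(2,0,1,0), (1,1,1,0), (0,2,1,0), (2,0,0,1), (1,1,0,1),
      (0,2,0,1)}"
  proof
    fix t assume "t \<in> Poly_Mapping.keys f"
    moreover obtain i j k l where t: "t = (i, j, k, l)" by (cases t)
    ultimately have "i + j = 2" "k + l = 1" using assms by (force simp: R_piece_def)+
    then have "i = 2 \<and> j = 0 \<or> i = 1 \<and> j = 1 \<or> i = 0 \<and> j = 2" "k = 1 \<and> l = 0 \<or> k = 0 \<and> l = 1"
        by auto
    then show "t \<in> {(2,0,1,0), (1,1,1,0), (0,2,1,0), (2,0,0,1), (1,1,0,1), (0,2,0,1)}"
      unfolding t by auto
  qed
  \<comment> \<open>\<open>?c k l i\<close> is the coefficient of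
    \<open>x^(2 - i) y^i z^k w^l\<close>.\<close>
  let ?c = "\<lambda>k l i. Poly_Mapping.lookup f (2 - i, i, k, l)"
  show ?thesis
    by (rule exI[of _ "?c 1 0"], rule exI[of _
        "?c 0 1"], subst R_eq_sum_over[OF _ keys]) (simp_all add: algebra_simps)
qed

lemma R_piece_mult: "f \<in> R_piece m n \<Longrightarrow> g \<in> R_piece m' n' \<Longrightarrow> f * g \<in> R_piece (m + m') (n + n')"
proof -
  assume a: "f \<in> R_piece m n" "g \<in> R_piece m' n'"
  have "bidegree (s + t) = (m + m', n + n')" if "s \<in> Poly_Mapping.keys f"
      "t \<in> Poly_Mapping.keys g" for s t
    using a that by (cases s; cases t) (fastforce simp: R_piece_def)
  then show "f * g \<in> R_piece (m + m') (n + n')"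
    using Poly_Mapping.keys_mult[of f g] unfolding R_piece_def by blast
qed

lemma R_piece_0 [simp]: "0 \<in> R_piece m n" by (simp add: R_piece_def)
lemma R_piece_add: "f \<in> R_piece m n \<Longrightarrow> g \<in> R_piece m n \<Longrightarrow> f + g \<in> R_piece m n"
  using Poly_Mapping.keys_add[of f g] by (auto simp: R_piece_def)
lemma R_piece_uminus: "f \<in> R_piece m n \<Longrightarrow> - f \<in> R_piece m n"
  by (simp add: R_piece_def)
lemma R_piece_diff: "f \<in> R_piece m n \<Longrightarrow> g \<in> R_piece m n \<Longrightarrow> f - g \<in> R_piece m n"
  using R_piece_add[of f m n "- g"] R_piece_uminus by force
lemma R_piece_sum: "(\<And>i. i \<in> A \<Longrightarrow> f i \<in> R_piece m n) \<Longrightarrow> sum f A \<in> R_piece m n"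
  by (induction A rule: infinite_finite_induct) (auto simp: R_piece_add)
lemma R_piece_gens: "const c \<in> R_piece 0 0" "var_x \<in> R_piece 1 0" "var_y \<in> R_piece 1 0"
    "var_z \<in> R_piece 0 1" "var_w \<in> R_piece 0 1"
  by (auto simp: R_piece_def const_def var_x_def var_y_def var_z_def var_w_def)

declare One_nat_def [simp del]

section \<open>Pencils of triples of quadrics\<close>

text \<open>Vectors are functions of which only the values at 0, 1, 2 matter.\<close>

definition dot :: "(nat \<Rightarrow> 'a::comm_ring_1) \<Rightarrow> (nat \<Rightarrow> 'a) \<Rightarrow> 'a" where
  "dot u v = u 0 * v 0 + u 1 * v 1 + u 2 * v 2"

definition cross :: "(nat \<Rightarrow> 'a::comm_ring_1) \<Rightarrow> (nat \<Rightarrow> 'a) \<Rightarrow> nat \<Rightarrow> 'a" where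
  "cross u v i = (if i = 0 then u 1 * v 2 - u 2 * v 1 else if i = 1 then u 2 * v 0 - u 0 * v 2
     else u 0 * v 1 - u 1 * v 0)"

lemma cross_simps [simp]:
  "cross u v 0 = u 1 * v 2 - u 2 * v 1"
  "cross u v 1 = u 2 * v 0 - u 0 * v 2"
  "cross u v (Suc 0) = u 2 * v 0 - u 0 * v 2"
  "cross u v 2 = u 0 * v 1 - u 1 * v 0"
  by (simp_all add: cross_def)

lemma minor_scale:
  "e * t * (f * t) - g * t * (h * t) = (e * f - g * h) * t ^ 2"
  "e * t ^ 2 * (f * t ^ 2) - g * t ^ 2 * (h * t ^ 2) = (e * f - g * h) * t ^ 4" for t :: "'a::idom"
  by Groebner_Basis.algebra+

lemma all_less_3: "(\<forall>i<3. P i) \<longleftrightarrow> P 0 \<and> P 1 \<and> P (2::nat)"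
  by (auto simp: less_Suc_eq numeral_3_eq_3 numeral_2_eq_2 One_nat_def)

text \<open>If \<open>v j\<close> is nonzero, the vanishing minors give the relation with
  coefficients \<open>v j\<close> and \<open>- u j\<close>.\<close>

lemma parallel_if_cross_eq_0:
  fixes u v :: "nat \<Rightarrow> 'k::field"
  assumes "\<forall>i<3. cross u v i = 0"
  shows "\<exists>c d. (c, d) \<noteq> (0, 0) \<and> (\<forall>i<3. c * u i + d * v i = 0)"
proof (cases "\<forall>i<3. v i = 0")
  case True
  then show ?thesis by (intro exI[of _ 0] exI[of _ 1]) simp
next
  case False
  then obtain j where j: "j < 3" "v j \<noteq> 0" by blast
  have "v j * u i + - u j * v i = 0" if "i < 3" for i
  proof -
    have "\<forall>j<3. \<forall>i<3. v j * u i + - u j * v i = 0"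
      using assms unfolding all_less_3 by (simp add: algebra_simps)
    then show ?thesis using j that by blast
  qed
  then show ?thesis using j by (intro exI[of _ "v j"] exI[of _ "- u j"]) simp
qed

lemma binary_quadric_has_root:
  fixes e0 e1 e2 :: "'k::alg_closed_field"
  obtains x y where "(x, y) \<noteq> (0, 0)" "x ^ 2 * e0 + x * y * e1 + y ^ 2 * e2 = 0"
proof -
  obtain x y where "(x, y) \<noteq> (0, 0)"
    "(\<Sum>i\<le>2. (if i = 0 then e2 else if i = 1 then e1 else e0) * x ^ i * y ^ (2 - i)) = 0"
    using binary_form_has_root[of 2 "\<lambda>i. if i = 0 then e2 else if i = 1 then e1 else e0"] by auto
  then show ?thesis
    by (intro that[of x y]) (simp_all add: numeral_2_eq_2 algebra_simps)
qed

text \<open>The columns of \<open>r\<close> hold the coefficients of three quadrics. Since all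
  minors vanish, these are multiples of the quadric in a column with a nonzero entry, and a root of
  that one is common to all.\<close>

lemma rank_1_quadrics_common_root:
  fixes r :: "nat \<Rightarrow> nat \<Rightarrow> 'k::alg_closed_field"
  assumes "\<forall>i<3. cross (r 1) (r 2) i = 0" "\<forall>i<3. cross (r 2) (r 0) i = 0"
      "\<forall>i<3. cross (r 0) (r 1) i = 0"
  shows "\<exists>x y. (x, y) \<noteq> (0, 0) \<and> (\<forall>j<3. x ^ 2 * r 0 j + x * y * r 1 j + y ^ 2 * r 2 j = 0)"
proof (cases "\<forall>i<3. \<forall>j<3. r i j = 0")
  case True
  then show ?thesis by (intro exI[of _ 0] exI[of _ 1]) simp
next
  case False
  then obtain i j where ij: "i < 3" "j < 3" "r i j \<noteq> 0" by blast
  obtain x y where xy: "(x, y) \<noteq> (0, 0)" "x ^ 2 * r 0 j + x * y * r 1 j + y ^ 2 * r 2 j = 0"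
    by (rule binary_quadric_has_root)
  have minor: "r i j * r i' j' = r i j' * r i' j" if "i' < 3" "j' < 3" for i' j'
  proof -
    have "\<forall>i<3. \<forall>j<3. \<forall>i'<3. \<forall>j'<3. r i j * r i' j' = r i j' * r i' j"
      using assms unfolding all_less_3 by (simp add: algebra_simps)
    then show ?thesis using ij that by blast
  qed
  have "x ^ 2 * r 0 j' + x * y * r 1 j' + y ^ 2 * r 2 j' = 0" if "j' < 3" for j'
  proof -
    have "r i j * (x ^ 2 * r 0 j' + x * y * r 1 j' + y ^ 2 * r 2 j') =
       x ^ 2 * (r i j * r 0 j') + x * y * (r i j * r 1 j') + y ^ 2 * (r i j * r 2 j')"
      by (simp add: algebra_simps)
    also have "\<dots> = r i j' * (x ^ 2 * r 0 j + x * y * r 1 j + y ^ 2 * r 2 j)"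
      using minor[of 0 j'] minor[of 1 j'] minor[of 2 j'] that by (simp add: algebra_simps)
    finally show ?thesis using xy ij by simp
  qed
  then show ?thesis using xy by blast
qed

text \<open>The conic \<open>h1^2 = h0 h2\<close> is the Veronese image of the projective line. A
  preimage is (h0, h1), or (0, 1) when \<open>h0\<close>, and with it \<open>h1\<close>,
  vanishes.\<close>

lemma veronese_point:
  fixes h0 h1 h2 :: "'k::field"
  assumes "h1 ^ 2 = h0 * h2" "(h0, h1, h2) \<noteq> (0, 0, 0)"
  obtains x y t where "(x, y) \<noteq> (0, 0)" "t \<noteq> 0" "x ^ 2 = t * h0" "x * y = t * h1" "y ^ 2 = t * h2"
proof (cases "h0 = 0")
  case True
  then show ?thesis using assms by (intro that[of 0 1 "inverse h2"]) auto
next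
  case False
  then show ?thesis using assms by (intro that[of h0 h1 h0]) (auto simp: power2_eq_square)
qed

section \<open>The pencil and its values at the points of either factor\<close>

locale quadric_pencil =
  fixes a b :: "nat \<Rightarrow> nat \<Rightarrow> 'k::alg_closed_field"
begin

definition A :: "nat \<Rightarrow> 'k R" where
  "A j = var_x ^ 2 * const (a 0 j) + var_x * var_y * const (a 1 j) + var_y ^ 2 * const (a 2 j)"
definition B :: "nat \<Rightarrow> 'k R" where
  "B j = var_x ^ 2 * const (b 0 j) + var_x * var_y * const (b 1 j) + var_y ^ 2 * const (b 2 j)"
definition p :: "nat \<Rightarrow> 'k R" where
  "p j = var_z * A j + var_w * B j"
definition r :: "nat \<Rightarrow> nat \<Rightarrow> 'k R" where
  "r i j = var_z * const (a i j) + var_w * const (b i j)"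
text \<open>The minors of the pencil: they all vanish at (x, y) exactly when a nontrivial
  combination of the values of \<open>A\<close> and \<open>B\<close> is zero, that is, when the
  \<open>p j\<close> have a common zero over (x, y).\<close>

definition s :: "nat \<Rightarrow> 'k R" where "s = cross A B"
text \<open>\<open>adj j\<close> is the \<open>j\<close>-th column of the adjugate of the matrix with rows \<open>r 0, r 1, r 2\<close>.\<close>

definition adj :: "nat \<Rightarrow> nat \<Rightarrow> 'k R" where
  "adj j = (if j = 0 then cross (r 1) (r 2) else if j
      = 1 then cross (r 2) (r 0) else cross (r 0) (r 1))"
definition D :: "'k R" where "D = dot (r 0) (adj 0)"
text \<open>The adjugate applied to the syzygies \<open>(y, -x, 0)\<close> and \<open>(0, y, -x)\<close> of \<open>(x\<^sup>2, xy, y\<^sup>2)\<close>.\<close>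

definition N1 :: "nat \<Rightarrow> 'k R" where "N1 i = var_y * adj 0 i - var_x * adj 1 i"
definition N2 :: "nat \<Rightarrow> 'k R" where "N2 i = var_y * adj 1 i - var_x * adj 2 i"

lemma adj_simps [simp]: "adj 0 = cross (r 1) (r 2)" "adj 1 = cross (r 2) (r 0)" "adj (Suc 0)
    = cross (r 2) (r 0)" "adj 2 = cross (r 0) (r 1)"
  by (simp_all add: adj_def)

lemma p_eq: "p j = var_x ^ 2 * r 0 j + var_x * var_y * r 1 j + var_y ^ 2 * r 2 j"
  by (simp add: p_def A_def B_def r_def algebra_simps)

lemma xhom_r: "xhom 0 (r i j)"
  unfolding r_def by (intro xhom_add xhom_mult[OF xhom_z xhom_const]
      xhom_mult[OF xhom_w xhom_const]) auto
lemma xhom_adj: "xhom 0 (adj j i)"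
  by (auto simp: adj_def cross_def intro!: xhom_diff xhom_mult[OF xhom_r xhom_r])
lemma xhom_A: "xhom 2 (A j)" and xhom_B: "xhom 2 (B j)"
  unfolding A_def B_def by (intro xhom_add xhom_mult[OF xhom_power[OF xhom_x] xhom_const]
      xhom_mult[OF xhom_mult[OF xhom_x xhom_y] xhom_const]
      xhom_mult[OF xhom_power[OF xhom_y] xhom_const]; simp)+
lemma xhom_p: "xhom 2 (p j)"
  unfolding p_def by (intro xhom_add xhom_mult[OF xhom_z xhom_A] xhom_mult[OF xhom_w xhom_B]) auto
lemma xhom_s: "xhom 4 (s j)"
  by (auto simp: s_def cross_def intro!: xhom_diff xhom_mult[OF xhom_A xhom_B])
lemma xhom_N1: "xhom 1 (N1 j)" and xhom_N2: "xhom 1 (N2 j)"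
  unfolding N1_def N2_def by (intro xhom_diff xhom_mult[OF xhom_x xhom_adj]
      xhom_mult[OF xhom_y xhom_adj]; simp)+

definition base_point_free :: bool where
  "base_point_free \<longleftrightarrow> (\<forall>x y c d. (x, y) \<noteq> (0, 0) \<longrightarrow> (c, d) \<noteq> (0, 0) \<longrightarrow> \<not> (\<forall>j<3. eval_R (p j) x y c d
      = 0))"

lemma eval_p: "eval_R (p j) x y c d = x ^ 2 * (c * a 0 j + d * b 0 j) + x * y * (c * a 1 j
    + d * b 1 j) + y ^ 2 * (c * a 2 j + d * b 2 j)"
  by (simp add: p_eq r_def eval_R_simps algebra_simps)

text \<open>Proportional values of \<open>A\<close> and \<open>B\<close> at (x, y) give (c, d) at
  which all \<open>p j\<close> vanish.\<close>

lemma s_eval_nonzero: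
  assumes "base_point_free" "(x, y) \<noteq> (0, 0)"
  shows "\<exists>j<3. cross (\<lambda>j. eval_R (A j) x y 0 0) (\<lambda>j. eval_R (B j) x y 0 0) j \<noteq> 0"
proof (rule ccontr)
  assume "\<not> ?thesis"
  then have "\<forall>j<3. cross (\<lambda>j. eval_R (A j) x y 0 0) (\<lambda>j. eval_R (B j) x y 0 0) j = 0" by blast
  from parallel_if_cross_eq_0[OF this] obtain c d where
    "(c, d) \<noteq> (0, 0)" "\<forall>i<3. c * eval_R (A i) x y 0 0 + d * eval_R (B i) x y 0 0 = 0" by blast
  moreover have "eval_R (p j) x y c d = c * eval_R (A j) x y 0 0 + d * eval_R (B j) x y 0 0" for j
    by (simp add: A_def B_def p_def eval_R_simps algebra_simps)
  ultimately show False using assms unfolding base_point_free_def by metis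
qed

text \<open>Restricted to the point where \<open>l\<close> vanishes, \<open>s j\<close> is its value
  there times \<open>t^4\<close>.\<close>

lemma linear_form_not_dvd_s:
  assumes "base_point_free" "l \<in> linear_forms var_x var_y"
  shows "\<exists>j<3. \<not> l dvd s j"
proof -
  obtain c d t where cd: "(c, d) \<noteq> (0, 0)" "t \<noteq> 0"
    "\<And>f. l dvd f \<longleftrightarrow> subst const (const c * t) (const d * t) var_z var_w f = 0"
    using linear_forms_xy_subst[OF assms(2)] by metis
  let ?f = "subst const (const c * t) (const d * t) var_z var_w"
  have AB: "?f (A j) = const (eval_R (A j) c d 0 0) * t ^ 2" "?f (B j)
      = const (eval_R (B j) c d 0 0) * t ^ 2" for j
    by (simp_all add: A_def B_def subst_const_simps eval_R_simps const_add const_mult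
        power2_eq_square algebra_simps)
  have "?f (s j) = const (cross (\<lambda>j. eval_R (A j) c d 0 0) (\<lambda>j. eval_R (B j) c d 0 0) j) * t ^ 4"
      for j
    by (simp add: s_def cross_def subst_const_simps AB const_diff const_mult minor_scale)
  then show ?thesis
    using s_eval_nonzero[OF assms(1) cd(1)] cd(2,3) by auto
qed

definition r_at :: "'k \<Rightarrow> 'k \<Rightarrow> nat \<Rightarrow> nat \<Rightarrow> 'k" where
  "r_at c d i j = c * a i j + d * b i j"
definition adj_at :: "'k \<Rightarrow> 'k \<Rightarrow> nat \<Rightarrow> nat \<Rightarrow> 'k" where
  "adj_at c d j = (if j = 0 then cross (r_at c d 1) (r_at c d 2) else if j
      = 1 then cross (r_at c d 2) (r_at c d 0) else cross (r_at c d 0) (r_at c d 1))"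

text \<open>A vanishing adjugate means rank at most 1, and then the three quadrics at (c, d) have a
  common root.\<close>

lemma adj_at_nonzero:
  assumes "base_point_free" "(c, d) \<noteq> (0, 0)"
  shows "\<exists>i<3. \<exists>j<3. adj_at c d j i \<noteq> 0"
proof (rule ccontr)
  assume "\<not> ?thesis"
  then have *: "\<forall>j<3. \<forall>i<3. adj_at c d j i = 0" by blast
  have "\<exists>x y. (x, y) \<noteq> (0, 0) \<and> (\<forall>j<3. x ^ 2 * r_at c d 0 j + x * y * r_at c d 1 j
      + y ^ 2 * r_at c d 2 j = 0)"
    using *[rule_format, of 0] *[rule_format, of 1] *[rule_format, of 2]
    by (intro rank_1_quadrics_common_root) (auto simp: adj_at_def)
  then show False
    using assms by (simp add: base_point_free_def eval_p r_at_def) metis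
qed

text \<open>
  A row of the adjugate at a zero of \<open>D\<close> spans the left kernel of the matrix; if it were of the form
  \<open>(x\<^sup>2, xy, y\<^sup>2)\<close>, then \<open>(x, y)\<close> would give a common zero of the \<open>p\<^sub>j\<close>.
\<close>

lemma adj_at_not_veronese:
  assumes "base_point_free" "(c, d) \<noteq> (0, 0)" "dot (r_at c d 0) (adj_at c d 0) = 0"
  shows "\<exists>i<3. adj_at c d 1 i ^ 2 \<noteq> adj_at c d 0 i * adj_at c d 2 i"
proof (rule ccontr)
  assume neg: "\<not> ?thesis"
  obtain i j where ij: "i < 3" "j < 3" "adj_at c d j i \<noteq> 0"
    using adj_at_nonzero[OF assms(1,2)] by blast
  then have nz: "(adj_at c d 0 i, adj_at c d 1 i, adj_at c d 2 i) \<noteq> (0, 0, 0)"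
    by (auto simp: numeral_3_eq_3 numeral_2_eq_2 less_Suc_eq One_nat_def)
  have "adj_at c d 1 i ^ 2 = adj_at c d 0 i * adj_at c d 2 i"
    using neg ij by blast
  then obtain x y t where xy: "(x, y) \<noteq> (0, 0)" "x ^ 2 = t * adj_at c d 0 i" "x * y
      = t * adj_at c d 1 i" "y ^ 2 = t * adj_at c d 2 i"
    using veronese_point[OF _ nz] by metis
  have "\<forall>i<3. \<forall>j<3. adj_at c d 0 i * r_at c d 0 j + adj_at c d 1 i * r_at c d 1 j
      + adj_at c d 2 i * r_at c d 2 j = 
     (if i = j then dot (r_at c d 0) (adj_at c d 0) else 0)"
    unfolding all_less_3 by (simp add: adj_at_def dot_def algebra_simps)
  then have *: "adj_at c d 0 i * r_at c d 0 j + adj_at c d 1 i * r_at c d 1 j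
      + adj_at c d 2 i * r_at c d 2 j = 0" if "j < 3" for j
    using ij that assms(3) by simp
  have "eval_R (p j) x y c d = t * (adj_at c d 0 i * r_at c d 0 j + adj_at c d 1 i * r_at c d 1 j
      + adj_at c d 2 i * r_at c d 2 j)" for j
    unfolding eval_p xy by (simp add: r_at_def algebra_simps)
  then have "\<forall>j<3. eval_R (p j) x y c d = 0" using * by simp
  then show False using assms(1,2) xy(1) unfolding base_point_free_def by blast
qed

lemma subst_r:
  "subst const var_x var_y (const c * t) (const d * t) (r i j) = const (r_at c d i j) * t"
  by (simp add: r_def r_at_def subst_const_simps const_add const_mult algebra_simps)

lemma subst_adj:
  "subst const var_x var_y (const c * t) (const d * t) (adj j i) = const (adj_at c d j i) * t ^ 2"
  by (simp add: adj_def adj_at_def cross_def subst_const_simps subst_r const_diff const_mult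
      minor_scale(1))

lemma linear_form_not_dvd_adj:
  assumes "base_point_free" "l \<in> linear_forms var_z var_w"
  shows "\<exists>i<3. \<exists>j<3. \<not> l dvd adj j i"
proof -
  obtain c d t where cd: "(c, d) \<noteq> (0, 0)" "t \<noteq> 0"
    "\<And>f. l dvd f \<longleftrightarrow> subst const var_x var_y (const c * t) (const d * t) f = 0"
    using linear_forms_zw_subst[OF assms(2)] by metis
  then show ?thesis
    using adj_at_nonzero[OF assms(1) cd(1)] by (simp add: cd(3) subst_adj)
qed

text \<open>\<open>l\<close> vanishes at a zero of \<open>D\<close>, where
  \<open>adj_at_not_veronese\<close> applies. The expression serves as the determinant of a linear
  system in the saturation proofs.\<close>

lemma linear_form_not_dvd_adj_minor:
  assumes "base_point_free" "l \<in> linear_forms var_z var_w" "l dvd D"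
  shows "\<exists>i<3. \<not> l dvd adj 1 i ^ 2 - adj 0 i * adj 2 i"
proof -
  obtain c d t where cd: "(c, d) \<noteq> (0, 0)" "t \<noteq> 0"
    "\<And>f. l dvd f \<longleftrightarrow> subst const var_x var_y (const c * t) (const d * t) f = 0"
    using linear_forms_zw_subst[OF assms(2)] by metis
  let ?f = "subst const var_x var_y (const c * t) (const d * t)"
  have "?f D = const (dot (r_at c d 0) (adj_at c d 0)) * t ^ 3"
    by (simp add: D_def dot_def subst_const_simps subst_r subst_adj const_add const_mult del:
        adj_simps) Groebner_Basis.algebra
  then have "dot (r_at c d 0) (adj_at c d 0) = 0" using assms(3) cd by simp
  then obtain i where i: "i < 3" "adj_at c d 1 i ^ 2 - adj_at c d 0 i * adj_at c d 2 i \<noteq> 0"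
    using adj_at_not_veronese[OF assms(1) cd(1)] by auto
  have "?f (adj 1 i ^ 2 - adj 0 i * adj 2 i) = const (adj_at c d 1 i ^ 2
      - adj_at c d 0 i * adj_at c d 2 i) * t ^ 4"
    by (simp add: subst_const_simps subst_adj const_diff const_mult power2_eq_square[of
        "adj_at _ _ _ _"] del: adj_simps) Groebner_Basis.algebra
  then show ?thesis using i cd(2,3) by auto
qed

end

section \<open>Identities and bidegrees of the syzygies\<close>

lemma exI2: "P x y \<Longrightarrow> \<exists>x y. P x y"
  by blast

lemma xhom_scale: "xhom d f \<Longrightarrow> xhom d (const c * f)" "xhom d f \<Longrightarrow> xhom d (f * const c)"
  by (auto intro: xhom_mult[OF xhom_const] xhom_mult[OF _ xhom_const])

text \<open>Carries divisibility from \<open>cross u k\<close> and \<open>cross v k\<close> over to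
  the products of \<open>cross u v\<close> with entries of \<open>k\<close>.\<close>

lemma cross_mult_entry:
  fixes u v k :: "nat \<Rightarrow> 'a::comm_ring_1"
  assumes "i < 3" "m < 3"
  shows "cross u v i * k m = v m * cross u k i - u m * cross v k i + (if i
      = m then dot u (cross v k) else 0)"
proof -
  have "\<forall>i<3. \<forall>m<3. cross u v i * k m = v m * cross u k i - u m * cross v k i + (if i
      = m then dot u (cross v k) else 0)"
    unfolding all_less_3 by (simp add: dot_def algebra_simps)
  then show ?thesis using assms by blast
qed

lemma dot_cross: "dot u (cross u v) = 0"
  by (simp add: dot_def algebra_simps)

context quadric_pencil
begin

lemma cross_p_A: "cross p A i = - (var_w * s i)" and cross_p_B: "cross p B i = var_z * s i"
  by (auto simp: cross_def p_def s_def algebra_simps)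

text \<open>Expand \<open>p\<close> by the rows of \<open>r\<close>; the cross product of two
  different rows is, up to sign, a column of the adjugate.\<close>

lemma cross_p_r:
  "cross p (r 0) i = var_y * N2 i"
  "cross p (r 1) i = - (var_y * N1 i) - var_x * N2 i"
  "cross p (r 2) i = var_x * N1 i"
  by (auto simp: cross_def p_eq N1_def N2_def power2_eq_square algebra_simps)

lemma dot_r_adj: 
  "dot (r 0) (adj 0) = D" "dot (r 1) (adj 0) = 0" "dot (r 2) (adj 0) = 0"
  "dot (r 0) (adj 1) = 0" "dot (r 1) (adj 1) = D" "dot (r 2) (adj 1) = 0"
  "dot (r 0) (adj 2) = 0" "dot (r 1) (adj 2) = 0" "dot (r 2) (adj 2) = D"
  by (simp_all add: dot_def D_def algebra_simps)

text \<open>Adjugate times matrix is \<open>D\<close> times the identity.\<close>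

lemma cramer:
  assumes "i < 3"
  shows "dot (r 0) u * adj 0 i + dot (r 1) u * adj 1 i + dot (r 2) u * adj 2 i = D * u i"
proof -
  have "\<forall>i<3. dot (r 0) u * adj 0 i + dot (r 1) u * adj 1 i + dot (r 2) u * adj 2 i = D * u i"
    unfolding all_less_3 by (simp add: dot_def D_def algebra_simps)
  then show ?thesis using assms by blast
qed

lemma dot_p: "dot p u = var_x ^ 2 * dot (r 0) u + var_x * var_y * dot (r 1) u
    + var_y ^ 2 * dot (r 2) u"
  by (simp add: dot_def p_eq algebra_simps)

lemma cross_p: "cross p u i = var_x ^ 2 * cross (r 0) u i + var_x * var_y * cross (r 1) u i
    + var_y ^ 2 * cross (r 2) u i"
  by (auto simp: cross_def p_eq algebra_simps)

lemma dot_p_gens: "dot p s = 0" "dot p (cross p u) = 0" "dot p N1 = 0" "dot p N2 = 0"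
proof -
  show "dot p s = 0" by (simp add: dot_def p_def s_def algebra_simps)
  show "dot p (cross p u) = 0" by (rule dot_cross)
  have "dot (r i) N1 = var_y * dot (r i) (adj 0) - var_x * dot (r i) (adj 1)"
    "dot (r i) N2 = var_y * dot (r i) (adj 1) - var_x * dot (r i) (adj 2)" for i
    by (simp_all add: dot_def N1_def N2_def algebra_simps)
  then show "dot p N1 = 0" "dot p N2 = 0"
    unfolding dot_p by (simp_all add: dot_r_adj power2_eq_square del: adj_simps)
qed

text \<open>Koszul syzygies solve \<open>A v = w g\<close>, \<open>B v = - z g\<close> for every
  \<open>g\<close> in the ideal of \<open>s\<close>, which allows such a \<open>g\<close> to be
  subtracted from a syzygy.\<close>

lemma dot_A_cross_p: "dot A (cross p u) = var_w * dot s u"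
  and dot_B_cross_p: "dot B (cross p u) = - (var_z * dot s u)"
  by (simp_all add: dot_def p_def s_def algebra_simps)

lemma R_piece_A: "A j \<in> R_piece 2 0" and R_piece_B: "B j \<in> R_piece 2 0"
  using R_piece_mult[OF R_piece_mult[OF R_piece_gens(2,2)] R_piece_gens(1)] R_piece_mult[OF
      R_piece_mult[OF R_piece_gens(2,3)] R_piece_gens(1)]
    R_piece_mult[OF R_piece_mult[OF R_piece_gens(3,3)] R_piece_gens(1)]
  by (auto simp: A_def B_def power2_eq_square intro!: R_piece_add)
lemma R_piece_r: "r i j \<in> R_piece 0 1"
  using R_piece_mult[OF R_piece_gens(4,1)] R_piece_mult[OF R_piece_gens(5,1)] by (auto simp: r_def
      intro!: R_piece_add)
lemma R_piece_p: "p j \<in> R_piece 2 1"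
  using R_piece_mult[OF R_piece_gens(4) R_piece_A] R_piece_mult[OF R_piece_gens(5) R_piece_B]
      by (auto simp: p_def intro!: R_piece_add)
lemma R_piece_s: "s j \<in> R_piece 4 0"
  using R_piece_mult[OF R_piece_A R_piece_B] by (auto simp: s_def cross_def intro!: R_piece_diff)
lemma R_piece_adj: "adj j i \<in> R_piece 0 2"
  using R_piece_mult[OF R_piece_r R_piece_r] by (auto simp: adj_def cross_def intro!: R_piece_diff)
lemma R_piece_D: "D \<in> R_piece 0 3"
  using R_piece_mult[OF R_piece_r R_piece_adj] by (auto simp: D_def dot_def simp del: adj_simps
      intro!: R_piece_add)
lemma R_piece_N1: "N1 j \<in> R_piece 1 2" and R_piece_N2: "N2 j \<in> R_piece 1 2"
  using R_piece_mult[OF R_piece_gens(2) R_piece_adj] R_piece_mult[OF R_piece_gens(3) R_piece_adj]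
      by (auto simp: N1_def N2_def simp del: adj_simps intro!: R_piece_diff)

end

section \<open>Saturation along the two projective lines\<close>

locale generic_pencil = quadric_pencil +
  assumes base_point_free: base_point_free and D_nonzero: "D \<noteq> 0"
begin

lemma D_splits: "D \<in> split_forms (linear_forms var_z var_w)"
proof -
  obtain e where e: "D = (\<Sum>i\<le>3. const (e i) * var_z ^ i * var_w ^ (3 - i))"
    using R_piece_binary_zw[of D 3] R_piece_D by auto
  show ?thesis
    unfolding e by (rule binary_form_splits) (use D_nonzero e in simp)
qed

lemma s_splits:
  assumes "s j \<noteq> 0"
  shows "s j \<in> split_forms (linear_forms var_x var_y)"
proof -
  obtain e where e: "s j = (\<Sum>i\<le>4. const (e i) * var_x ^ i * var_y ^ (4 - i))"
    using R_piece_binary[of "s j" 4] R_piece_s[of j] by auto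
  show ?thesis
    unfolding e by (rule binary_form_splits) (use assms e in simp)
qed

lemma s_nonzero: "\<exists>j<3. s j \<noteq> 0"
  using linear_form_not_dvd_s[OF base_point_free, of var_y] by (auto simp: linear_forms_def)

text \<open>Some \<open>s j\<close> is not divisible by the prime \<open>l\<close>, so
  \<open>l\<close> divides \<open>t\<close>.\<close>

lemma saturated_s: "saturated (linear_forms var_x var_y) (\<lambda>u. \<exists>t. \<forall>i<3. u i = t * s i)"
  unfolding saturated_def
proof (intro conjI allI impI ballI)
  fix c and u :: "nat \<Rightarrow> 'a R"
  assume "\<exists>t. \<forall>i<3. u i = t * s i"
  then obtain t where "\<forall>i<3. u i = t * s i" ..
  then show "\<exists>t. \<forall>i<3. const c * u i = t * s i" by (intro exI[of _ "const c * t"]) simp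
next
  fix l and u :: "nat \<Rightarrow> 'a R"
  assume l: "l \<in> linear_forms var_x var_y" and "\<exists>t. \<forall>i<3. l * u i = t * s i"
  then obtain t where t: "\<And>i. i < 3 \<Longrightarrow> l * u i = t * s i" by blast
  obtain j where j: "j < 3" "\<not> l dvd s j" using linear_form_not_dvd_s[OF base_point_free l] by blast
  have "l dvd t * s j" using t[OF j(1)] by (metis dvd_triv_left)
  then obtain t' where "t = l * t'" using j l linear_form_dvd_mult[of l] by (auto elim: dvdE)
  then show "\<exists>t. \<forall>i<3. u i = t * s i"
    using t linear_form_nonzero[of l] l by (intro exI[of _ t']) (auto simp: mult.assoc)
qed

text \<open>Cross products with \<open>B\<close> and \<open>A\<close> exhibit the entries of
  \<open>f s\<close> and \<open>g s\<close> as multiples of \<open>l\<close>, while some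
  \<open>s j\<close> is not one.\<close>

lemma saturated_AB: "saturated (linear_forms var_x var_y) (\<lambda>u. \<exists>f g. \<forall>i<3. u i = f * A i + g * B i)"
  unfolding saturated_def
proof (intro conjI allI impI ballI)
  fix c and u :: "nat \<Rightarrow> 'a R"
  assume "\<exists>f g. \<forall>i<3. u i = f * A i + g * B i"
  then obtain f g where "\<forall>i<3. u i = f * A i + g * B i" by blast
  then show "\<exists>f g. \<forall>i<3. const c * u i = f * A i + g * B i"
    by (intro exI2[of _ "const c * f" "const c * g"]) (simp add: algebra_simps)
next
  fix l and u :: "nat \<Rightarrow> 'a R"
  assume l: "l \<in> linear_forms var_x var_y" and "\<exists>f g. \<forall>i<3. l * u i = f * A i + g * B i"
  then obtain f g where t: "\<And>i. i < 3 \<Longrightarrow> l * u i = f * A i + g * B i" by blast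
  obtain j where j: "j < 3" "\<not> l dvd s j" using linear_form_not_dvd_s[OF base_point_free l] by blast
  have t': "l * u 0 = f * A 0 + g * B 0" "l * u 1 = f * A 1 + g * B 1" "l * u 2 = f * A 2 + g * B 2"
    using t by simp_all
  have "\<forall>i<3. f * s i = l * cross u B i \<and> g * s i = l * cross A u i"
    unfolding all_less_3 s_def cross_simps
    by (insert t', intro conjI; Groebner_Basis.algebra)
  then have "l dvd f * s j" "l dvd g * s j" using j by auto
  then obtain f' g' where "f = l * f'" "g = l * g'" using j l linear_form_dvd_mult[of l]
      by (auto elim!: dvdE)
  then have "l * u i = l * (f' * A i + g' * B i)" if "i < 3" for i
    using t[OF that] by (simp add: algebra_simps)
  then show "\<exists>f g. \<forall>i<3. u i = f * A i + g * B i"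
    using linear_form_nonzero[of l] l by (intro exI2[of _ f' g']) auto
qed

text \<open>The coefficients of x and y show that \<open>l\<close> divides
  \<open>f adj 1 + g adj 2\<close> and \<open>f adj 0 + g adj 1\<close> entrywise. How
  \<open>f\<close> and \<open>g\<close> are isolated depends on whether \<open>r\<close> is singular
  where \<open>l\<close> vanishes.\<close>

lemma saturated_N:
  "saturated (linear_forms var_z var_w) (\<lambda>u. \<exists>f g. xhom 0 f \<and> xhom 0 g \<and> (\<forall>i<3. u i = f * N1 i
      + g * N2 i))"
  unfolding saturated_def
proof (intro conjI allI impI ballI)
  fix c and u :: "nat \<Rightarrow> 'a R"
  assume "\<exists>f g. xhom 0 f \<and> xhom 0 g \<and> (\<forall>i<3. u i = f * N1 i + g * N2 i)"
  then obtain f g where "xhom 0 f" "xhom 0 g" "\<forall>i<3. u i = f * N1 i + g * N2 i" by blast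
  then show "\<exists>f g. xhom 0 f \<and> xhom 0 g \<and> (\<forall>i<3. const c * u i = f * N1 i + g * N2 i)"
    by (intro exI2[of _ "const c * f" "const c * g"]) (simp add: algebra_simps xhom_scale)
next
  fix l and u :: "nat \<Rightarrow> 'a R"
  assume l: "l \<in> linear_forms var_z var_w" and "\<exists>f g. xhom 0 f \<and> xhom 0 g \<and> (\<forall>i<3. l * u i
      = f * N1 i + g * N2 i)"
  then obtain f g where fg: "xhom 0 f" "xhom 0 g" and t: "\<And>i. i < 3 \<Longrightarrow> l * u i = f * N1 i
      + g * N2 i" by blast
  have l0: "l \<noteq> 0" using l linear_form_nonzero by blast
  have x: "xhom 0 (f * adj i k + g * adj j k)" for i j k
    by (intro xhom_add xhom_mult[OF _ xhom_adj]) (use fg in auto)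
  have "l dvd var_x * (- (f * adj 1 i + g * adj 2 i)) + var_y * (f * adj 0 i + g * adj 1 i)" if
      "i < 3" for i
  proof -
    have "l * u i = var_x * (- (f * adj 1 i + g * adj 2 i)) + var_y * (f * adj 0 i + g * adj 1 i)"
      unfolding t[OF that] by (simp add: N1_def N2_def algebra_simps del: adj_simps)
    then show ?thesis by (metis dvd_triv_left)
  qed
  from linear_form_dvd_linear[OF l xhom_uminus[OF x] x this]
  have d: "l dvd f * adj 1 i + g * adj 2 i" "l dvd f * adj 0 i + g * adj 1 i" if "i < 3" for i
    using that by (auto simp only: dvd_minus_iff)
  have "l dvd f \<and> l dvd g"
  proof (cases "l dvd D")
    case True
    then obtain i where i: "i < 3" "\<not> l dvd adj 1 i ^ 2 - adj 0 i * adj 2 i"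
      using linear_form_not_dvd_adj_minor[OF base_point_free l] by blast
    \<comment> \<open>Cramer's rule for the two conditions at index \<open>i\<close>.\<close>
    have "f * (adj 1 i ^ 2 - adj 0 i * adj 2 i) = (f * adj 1 i + g * adj 2 i) * adj 1 i
        - (f * adj 0 i + g * adj 1 i) * adj 2 i"
      "g * (adj 1 i ^ 2 - adj 0 i * adj 2 i) = (f * adj 0 i + g * adj 1 i) * adj 1 i
          - (f * adj 1 i + g * adj 2 i) * adj 0 i"
      by (simp_all add: algebra_simps power2_eq_square del: adj_simps)
    then have "l dvd f * (adj 1 i ^ 2 - adj 0 i * adj 2 i)" "l dvd g * (adj 1 i ^ 2
        - adj 0 i * adj 2 i)"
      using d[OF i(1)] by (simp_all only: dvd_diff dvd_mult2)
    then show ?thesis using i linear_form_dvd_mult[of l] l by blast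
  next
    case False
    \<comment> \<open>The rows \<open>r 0\<close> and \<open>r 1\<close> are dual to the columns of
      the adjugate up to the factor \<open>D\<close>, so they isolate \<open>f D\<close> and
      \<open>g D\<close>.\<close>
    have "dot v (\<lambda>i. f * adj 0 i + g * adj 1 i) = f * dot v (adj 0) + g * dot v (adj 1)" for v
      by (simp add: dot_def algebra_simps del: adj_simps)
    then have "f * D = dot (r 0) (\<lambda>i. f * adj 0 i + g * adj 1 i)" "g * D
        = dot (r 1) (\<lambda>i. f * adj 0 i + g * adj 1 i)"
      by (simp_all add: dot_r_adj del: adj_simps)
    moreover have "l dvd dot v (\<lambda>i. f * adj 0 i + g * adj 1 i)" for v
      unfolding dot_def using d(2)[of 0] d(2)[of 1] d(2)[of 2] by (simp add: dvd_add del: adj_simps)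
    ultimately have "l dvd f * D" "l dvd g * D" by simp_all
    then show ?thesis using False linear_form_dvd_mult[of l] l by blast
  qed
  then obtain f' g' where f': "f = l * f'" "g = l * g'" by (auto elim!: dvdE)
  then have "l * u i = l * (f' * N1 i + g' * N2 i)" if "i < 3" for i
    using t[OF that] by (simp add: algebra_simps)
  moreover have "xhom 0 f'" "xhom 0 g'"
    using fg xhom_0_cancel[OF linear_form_zw_xhom[OF l]] l0 unfolding f' by blast+
  ultimately show "\<exists>f g. xhom 0 f \<and> xhom 0 g \<and> (\<forall>i<3. u i = f * N1 i + g * N2 i)"
    using l0 by (intro exI2[of _ f' g']) auto
qed

lemma xhom_cross_r: "\<forall>i<3. xhom 0 (k i) \<Longrightarrow> xhom 0 (cross (r j) k i)"
  by (auto simp: cross_def all_less_3 intro!: xhom_diff xhom_mult[OF xhom_r])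

text \<open>By \<open>cross_p_r\<close> the four products of x, y with \<open>N1\<close>,
  \<open>N2\<close> leave only \<open>y N1\<close> modulo Koszul syzygies. In the proof
  \<open>l\<close> divides first \<open>c\<close>, then every \<open>cross (r j) k\<close>, and
  finally \<open>k\<close>.\<close>

lemma saturated_K:
  "saturated (linear_forms var_z var_w) (\<lambda>u. \<exists>k c. (\<forall>i<3. xhom 0 (k i)) \<and> xhom 0 c \<and> (\<forall>i<3. u i
      = cross p k i + c * var_y * N1 i))"
  unfolding saturated_def
proof (intro conjI allI impI ballI)
  fix e and u :: "nat \<Rightarrow> 'a R"
  assume "\<exists>k c. (\<forall>i<3. xhom 0 (k i)) \<and> xhom 0 c \<and> (\<forall>i<3. u i = cross p k i + c * var_y * N1 i)"
  then obtain k c where "\<forall>i<3. xhom 0 (k i)" "xhom 0 c" "\<forall>i<3. u i = cross p k i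
      + c * var_y * N1 i" by blast
  then show "\<exists>k c. (\<forall>i<3. xhom 0 (k i)) \<and> xhom 0 c \<and> (\<forall>i<3. const e * u i = cross p k i
      + c * var_y * N1 i)"
    by (intro exI2[of _ "\<lambda>i. const e * k i" "const e * c"]) (auto simp: algebra_simps cross_def
        xhom_scale)
next
  fix l and u :: "nat \<Rightarrow> 'a R"
  assume l: "l \<in> linear_forms var_z var_w" and
    "\<exists>k c. (\<forall>i<3. xhom 0 (k i)) \<and> xhom 0 c \<and> (\<forall>i<3. l * u i = cross p k i + c * var_y * N1 i)"
  then obtain k c where k: "\<forall>i<3. xhom 0 (k i)" and c: "xhom 0 c" and
    t: "\<And>i. i < 3 \<Longrightarrow> l * u i = cross p k i + c * var_y * N1 i" by blast
  have l0: "l \<noteq> 0" using l linear_form_nonzero by blast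
  have x: "xhom 0 (cross (r j) k i)" "xhom 0 (cross (r j) k i - c * adj j' i')"
      "xhom 0 (cross (r j) k i + c * adj j' i')" for i j i' j'
    using c xhom_cross_r[OF k] by (auto intro!: xhom_add xhom_diff
        xhom_mult[OF _ xhom_adj] simp del: cross_simps adj_simps)
  have "l dvd var_x ^ 2 * cross (r 0) k i + var_x * var_y * (cross (r 1) k i - c * adj 1 i)
      + var_y ^ 2 * (cross (r 2) k i + c * adj 0 i)" if "i < 3" for i
  proof -
    have "l * u i = var_x ^ 2 * cross (r 0) k i + var_x * var_y * (cross (r 1) k i - c * adj 1 i)
        + var_y ^ 2 * (cross (r 2) k i + c * adj 0 i)"
      unfolding t[OF that] by (simp add: N1_def cross_p algebra_simps power2_eq_square del:
          adj_simps cross_simps)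
    then show ?thesis by (metis dvd_triv_left)
  qed
  note d = linear_form_dvd_quadratic[OF l x(1) x(2) x(3) this]
  have "l dvd c"
  proof (cases "l dvd D")
    case True
    then obtain i where i: "i < 3" "\<not> l dvd adj 1 i ^ 2 - adj 0 i * adj 2 i"
      using linear_form_not_dvd_adj_minor[OF base_point_free l] by blast
    \<comment> \<open>Row \<open>i\<close> of the adjugate combines the rows of \<open>r\<close> to
      \<open>D\<close> times the unit vector \<open>e_i\<close>, and entry \<open>i\<close> of the
      cross product of \<open>e_i\<close> with \<open>k\<close> is 0.\<close>
    have "adj 0 i * cross (r 0) k i + adj 1 i * cross (r 1) k i + adj 2 i * cross (r 2) k i = 0"
      using i(1) by (simp add: adj_def cross_def algebra_simps)
    then have "c * (adj 1 i ^ 2 - adj 0 i * adj 2 i) =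
      - (adj 0 i * cross (r 0) k i + adj 1 i * (cross (r 1) k i - c * adj 1 i)
          + adj 2 i * (cross (r 2) k i + c * adj 0 i))"
      by (simp add: algebra_simps power2_eq_square del: adj_simps cross_simps)
    moreover have "l dvd adj 0 i * cross (r 0) k i + adj 1 i * (cross (r 1) k i - c * adj 1 i)
        + adj 2 i * (cross (r 2) k i + c * adj 0 i)"
      using d[OF i(1)] by (simp only: dvd_add dvd_mult)
    ultimately have "l dvd c * (adj 1 i ^ 2 - adj 0 i * adj 2 i)" by (simp only: dvd_minus_iff)
    then show ?thesis using i linear_form_dvd_mult[of l] l by blast
  next
    case False
    have "dot (r 1) (\<lambda>i. cross (r 1) k i - c * adj 1 i) = dot (r 1) (cross (r 1) k)
        - c * dot (r 1) (adj 1)"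
      by (simp add: dot_def algebra_simps del: adj_simps cross_simps)
    \<comment> \<open>\<open>r 1\<close> is orthogonal to \<open>cross (r 1) k\<close>, so only the
      term with \<open>c\<close> survives.\<close>
    then have "c * D = - dot (r 1) (\<lambda>i. cross (r 1) k i - c * adj 1 i)"
      by (simp add: dot_cross dot_r_adj del: adj_simps cross_simps)
    moreover have "l dvd dot (r 1) (\<lambda>i. cross (r 1) k i - c * adj 1 i)"
      unfolding dot_def using d(2)[of 0] d(2)[of 1] d(2)[of 2]
          by (simp add: dvd_add del: adj_simps cross_simps)
    ultimately have "l dvd c * D" by simp
    then show ?thesis using False linear_form_dvd_mult[of l] l by blast
  qed
  then obtain c' where c': "c = l * c'" by (auto elim: dvdE)
  have rk: "l dvd cross (r j) k i" if "i < 3" "j < 3" for i j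
  proof -
    have "cross (r 1) k i = (cross (r 1) k i - c * adj 1 i) + c * adj 1 i" "cross (r 2) k i
        = (cross (r 2) k i + c * adj 0 i) - c * adj 0 i"
      by simp_all
    then have "l dvd cross (r 0) k i \<and> l dvd cross (r 1) k i \<and> l dvd cross (r 2) k i"
      using d[OF that(1)] \<open>l dvd c\<close> by (metis dvd_add dvd_diff dvd_mult2)
    then show ?thesis using that by (auto simp: less_Suc_eq numeral_3_eq_3 numeral_2_eq_2
        One_nat_def)
  qed
  obtain i j where ij: "i < 3" "j < 3" "\<not> l dvd adj j i"
    using linear_form_not_dvd_adj[OF base_point_free l] by blast
  \<comment> \<open>Adjugate entries are entries of cross products of two rows, so
    \<open>cross_mult_entry\<close> applies to the one not divisible by \<open>l\<close>.\<close>
  have cc: "l dvd cross (r a) (r b) i * k m" if "a < 3" "b < 3" "m < 3" for a b m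
  proof -
    have "l dvd dot v (cross (r b) k)" for v
      unfolding dot_def using rk[OF _ that(2)] by (simp add: dvd_add del: cross_simps)
    then show ?thesis
      unfolding cross_mult_entry[OF ij(1) that(3)] using rk[OF ij(1)] that by simp
  qed
  have "l dvd adj j i * k m" if "m < 3" for m
    using ij(2) that by (simp add: adj_def cc del: cross_simps)
  then have "\<forall>m<3. l dvd k m" using ij linear_form_dvd_mult[of l] l by blast
  then obtain k' where k': "\<And>m. m < 3 \<Longrightarrow> k m = l * k' m" unfolding dvd_def by metis
  have "l * u i = l * (cross p k' i + c' * var_y * N1 i)" if "i < 3" for i
    using t[OF that] by (simp add: cross_def k' c' algebra_simps)
  moreover have "xhom 0 (k' i)" if "i < 3" for i
    using k that l0 xhom_0_cancel[OF linear_form_zw_xhom[OF l]] k' by metis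
  moreover have "xhom 0 c'"
    using c l0 xhom_0_cancel[OF linear_form_zw_xhom[OF l]] c' by metis
  ultimately show "\<exists>k c. (\<forall>i<3. xhom 0 (k i)) \<and> xhom 0 c \<and> (\<forall>i<3. u i = cross p k i
      + c * var_y * N1 i)"
    using l0 by (intro exI2[of _ k' c']) auto
qed

end

section \<open>Syzygies of low degree in x and y\<close>

lemma xpart_mult_right: "xhom e g \<Longrightarrow> xpart d (f * g) = (if e \<le> d then xpart (d - e) f * g else 0)"
  using xpart_mult[of e g d f] by (simp add: mult.commute)

lemma xpart_dot:
  assumes "\<And>j. xhom e (u j)"
  shows "xpart d (dot u v) = (if e \<le> d then dot u (\<lambda>j. xpart (d - e) (v j)) else 0)"
  by (simp add: dot_def xpart_add xpart_mult[OF assms])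

lemma xpart_cross:
  assumes "\<And>j. xhom e (u j)"
  shows "xpart d (cross u v i) = (if e \<le> d then cross u (\<lambda>j. xpart (d - e) (v j)) i else 0)"
  by (simp add: cross_def xpart_diff xpart_mult[OF assms])

lemma decompose_xy:
  fixes f :: "'k::comm_ring_1 R"
  obtains g h where "f = xpart 0 f + var_x * g + var_y * h"
proof -
  have "\<exists>g h. f - (\<Sum>d<1. xpart d f) = var_x * g + var_y * h"
  proof (rule xy_power_ideal[where J = "\<lambda>f. \<exists>g h. f = var_x * g + var_y * h"])
    fix f f' :: "'k R"
    assume "\<exists>g h. f = var_x * g + var_y * h" "\<exists>g h. f' = var_x * g + var_y * h"
    then obtain g h g' h' where "f = var_x * g + var_y * h" "f' = var_x * g' + var_y * h'" by blast
    then show "\<exists>g h. f + f' = var_x * g + var_y * h"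
      by (intro exI2[of _ "g + g'" "h + h'"]) (simp add: algebra_simps)
  next
    fix f f' :: "'k R"
    assume "\<exists>g h. f = var_x * g + var_y * h"
    then obtain g h where "f = var_x * g + var_y * h" by blast
    then show "\<exists>g h. f * f' = var_x * g + var_y * h"
      by (intro exI2[of _ "g * f'" "h * f'"]) (simp add: algebra_simps)
  next
    fix i :: nat assume "i \<le> 1"
    then consider "i = 0" | "i = 1" by linarith
    then show "\<exists>g h. (var_x :: 'k R) ^ i * var_y ^ (1 - i) = var_x * g + var_y * h"
    proof cases
      case 1 then show ?thesis by (intro exI2[of _ 0 1]) simp
    next
      case 2 then show ?thesis by (intro exI2[of _ 1 0]) simp
    qed
  qed
  then obtain g h where "f - xpart 0 f = var_x * g + var_y * h" by (auto simp: One_nat_def)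
  then show ?thesis by (intro that[of g h]) (simp add: algebra_simps)
qed

lemma xhom_1_decompose:
  fixes f :: "'k::comm_ring_1 R"
  assumes "xhom 1 f"
  obtains g h where "xhom 0 g" "xhom 0 h" "f = var_x * g + var_y * h"
proof -
  obtain g h where "f = xpart 0 f + var_x * g + var_y * h" by (rule decompose_xy)
  then have "xpart 1 f = xpart 1 (xpart 0 f + var_x * g + var_y * h)" by simp
  then have "f = var_x * xpart 0 g + var_y * xpart 0 h"
    using assms by (simp add: xpart_add xpart_mult[OF xhom_x]
        xpart_mult[OF xhom_y] xpart_xhom[OF xhom_xpart] xpart_xhom[OF assms])
  then show ?thesis by (intro that[of "xpart 0 g" "xpart 0 h"] xhom_xpart)
qed

context generic_pencil
begin

text \<open>The Hilbert-Burch description of the syzygies of \<open>s\<close>: an explicit identity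
  handles \<open>s j\<close> times \<open>u\<close>, and saturation cancels
  \<open>s j\<close>.\<close>

lemma relation_s_in_AB:
  assumes "dot s u = 0"
  shows "\<exists>f g. \<forall>i<3. u i = f * A i + g * B i"
proof -
  obtain j where j: "j < 3" "s j \<noteq> 0" using s_nonzero by blast
  have "\<forall>j<3. \<forall>i<3. s j * u i = cross u B j * A i + cross A u j * B i + (if i
      = j then dot s u else 0)"
    unfolding all_less_3 by (simp add: s_def dot_def algebra_simps)
  then have "\<forall>i<3. s j * u i = cross u B j * A i + cross A u j * B i"
    using assms j by simp
  then have "\<exists>f g. \<forall>i<3. s j * u i = f * A i + g * B i" by blast
  then show ?thesis
    by (rule saturated_cancel[OF saturated_AB s_splits[OF j(2)]])
qed

text \<open>A vector orthogonal to \<open>A\<close> and \<open>B\<close> is proportional to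
  \<open>s\<close>, first after multiplication by \<open>s j\<close>, which saturation then
  cancels.\<close>

lemma kernel_AB:
  assumes "dot A u = 0" "dot B u = 0"
  shows "\<exists>t. \<forall>i<3. u i = t * s i"
proof -
  obtain j where j: "j < 3" "s j \<noteq> 0" using s_nonzero by blast
  have "\<forall>j<3. \<forall>i<3. s j * u i = u j * s i"
    unfolding all_less_3 using assms
    by (simp add: s_def dot_def)
      (intro conjI; Groebner_Basis.algebra)
  then have "\<exists>t. \<forall>i<3. s j * u i = t * s i" using j by blast
  then show ?thesis
    by (rule saturated_cancel[OF saturated_s s_splits[OF j(2)]])
qed

lemma syzygy_xdeg_0:
  assumes "\<And>i. xhom 0 (u i)" "dot p u = 0" "i < 3"
  shows "u i = 0"
proof -
  have x: "xhom 0 (dot (r j) u)" for j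
    unfolding dot_def by (intro xhom_add xhom_mult[OF xhom_r assms(1)]) auto
  have "dot (r 0) u = 0" "dot (r 1) u = 0" "dot (r 2) u = 0"
    using xhom_0_quadratic_eq_0[OF x x x assms(2)[unfolded dot_p]] by blast+
  then show ?thesis using cramer[OF assms(3), of u] D_nonzero by simp
qed

text \<open>The vector of the \<open>dot (r j) u\<close> is a syzygy of (x^2, xy, y^2). The adjugate
  turns it into \<open>D u\<close> and the two generating syzygies into \<open>N1\<close> and
  \<open>N2\<close>.\<close>

lemma syzygy_xdeg:
  assumes "\<And>i. xhom d (u i)" "dot p u = 0" "d = e + 1"
  obtains n1 n2 where "xhom e n1" "xhom e n2" "\<And>i. i < 3 \<Longrightarrow> D * u i = n1 * N1 i + n2 * N2 i"
proof -
  obtain n1 n2 where n: "dot (r 0) u = var_y * n1" "dot (r 1) u = var_y * n2 - var_x * n1"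
      "dot (r 2) u = - (var_x * n2)"
    using quadrics_syzygy[OF assms(2)[unfolded dot_p]] by metis
  have x: "xpart d (dot (r j) u) = dot (r j) u" for j
    by (simp add: xpart_dot[OF xhom_r] xpart_xhom[OF assms(1)])
  \<comment> \<open>Passing to the parts of degree \<open>e\<close> makes the coefficients
    homogeneous.\<close>
  let ?n1 = "xpart e n1" and ?n2 = "xpart e n2"
  have n': "dot (r 0) u = var_y * ?n1" "dot (r 1) u = var_y * ?n2 - var_x * ?n1" "dot (r 2) u =
      - (var_x * ?n2)"
    using assms(3) x[of 0, unfolded n(1)] x[of 1, unfolded n(2)] x[of 2, unfolded n(3)] n
    by (simp_all add: xpart_diff xpart_mult[OF xhom_x] xpart_mult[OF xhom_y] xpart_uminus)
  have "D * u i = ?n1 * N1 i + ?n2 * N2 i" if "i < 3" for i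
    unfolding cramer[OF that, symmetric] n' by (simp add: N1_def N2_def algebra_simps del:
        adj_simps)
  then show ?thesis by (intro that[of ?n1 ?n2] xhom_xpart)
qed

lemma syzygy_xdeg_1:
  assumes "\<And>i. xhom 1 (u i)" "dot p u = 0"
  shows "\<exists>f g. xhom 0 f \<and> xhom 0 g \<and> (\<forall>i<3. u i = f * N1 i + g * N2 i)"
proof (rule saturated_cancel[OF saturated_N D_splits])
  obtain n1 n2 where "xhom 0 n1" "xhom 0 n2" "\<And>i. i < 3 \<Longrightarrow> D * u i = n1 * N1 i + n2 * N2 i"
    using syzygy_xdeg[OF assms, of 0] by auto
  then show "\<exists>f g. xhom 0 f \<and> xhom 0 g \<and> (\<forall>i<3. D * u i = f * N1 i + g * N2 i)" by blast
qed

lemma cross_p_combination: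
  "cross p (\<lambda>i. b0 * r 0 i + b1 * r 1 i + b2 * r 2 i) i = (var_x * b2 - var_y * b1) * N1 i
      + (var_y * b0 - var_x * b1) * N2 i"
proof -
  have "cross p (\<lambda>i. b0 * r 0 i + b1 * r 1 i + b2 * r 2 i) i = b0 * cross p (r 0) i
      + b1 * cross p (r 1) i + b2 * cross p (r 2) i"
    by (simp add: cross_def algebra_simps)
  then show ?thesis by (simp add: cross_p_r algebra_simps)
qed

lemma syzygy_xdeg_2:
  assumes "\<And>i. xhom 2 (u i)" "dot p u = 0"
  shows "\<exists>k c. (\<forall>i<3. xhom 0 (k i)) \<and> xhom 0 c \<and> (\<forall>i<3. u i = cross p k i + c * var_y * N1 i)"
proof (rule saturated_cancel[OF saturated_K D_splits])
  obtain n1 n2 where n: "xhom 1 n1" "xhom 1 n2" "\<And>i. i < 3 \<Longrightarrow> D * u i = n1 * N1 i + n2 * N2 i"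
    using syzygy_xdeg[OF assms, of 1] by auto
  obtain n11 n12 where n1: "xhom 0 n11" "xhom 0 n12" "n1 = var_x * n11 + var_y * n12"
    using n(1) by (rule xhom_1_decompose)
  obtain n21 n22 where n2: "xhom 0 n21" "xhom 0 n22" "n2 = var_x * n21 + var_y * n22"
    using n(2) by (rule xhom_1_decompose)
  \<comment> \<open>By \<open>cross_p_combination\<close> this choice yields the coefficient
    \<open>x n11 + y n21\<close> at \<open>N1\<close> and all of \<open>n2\<close> at
    \<open>N2\<close>; what remains is \<open>(n12 - n21) y N1\<close>.\<close>
  let ?k = "\<lambda>i. n22 * r 0 i + (- n21) * r 1 i + n11 * r 2 i"
  have "D * u i = cross p ?k i + (n12 - n21) * var_y * N1 i" if "i < 3" for i
    unfolding n(3)[OF that] n1(3) n2(3) cross_p_combination by (simp add: algebra_simps)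
  moreover have "xhom 0 (?k i)" for i
    by (intro xhom_add xhom_mult[OF _ xhom_r] xhom_uminus) (use n1 n2 in auto)
  ultimately show "\<exists>k c. (\<forall>i<3. xhom 0 (k i)) \<and> xhom 0 c \<and> (\<forall>i<3. D * u i = cross p k i
      + c * var_y * N1 i)"
    using n1 n2 by (intro exI2[of _ ?k "n12 - n21"]) (simp add: xhom_diff)
qed

end

section \<open>The ideal of the quartics and syzygies of high degree\<close>

lemma const_sum: "const (sum f A) = (\<Sum>i\<in>A. const (f i))"
  by (induction A rule: infinite_finite_induct) (simp_all add: const_add)

context generic_pencil
begin

text \<open>
  The products of the three quartics \<open>s\<^sub>j\<close> with \<open>x\<close> and \<open>y\<close> are six elements of the
  six-dimensional space of quintics, and they are independent because the syzygies of \<open>s\<close> are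
  generated by the quadratic ones \<open>A\<close> and \<open>B\<close>.
\<close>

lemma xy_quintics_in_ideal_s:
  assumes "i \<le> 5"
  shows "\<exists>k. var_x ^ i * var_y ^ (5 - i) = dot s k"
proof -
  \<comment> \<open>The six quintics, their coefficient matrix \<open>Q\<close>, and the triple of
    linear forms \<open>L v\<close> for which \<open>dot s (L v)\<close> is the combination with
    weights \<open>v\<close>.\<close>
  define g where "g c = (if c < 3 then s c * var_x else s (c - 3) * var_y)" for c
  define Q where "Q = mat 6 6 (\<lambda>(e, c). Poly_Mapping.lookup (g c) (e, 5 - e, 0, 0))"
  define L where "L v j = const (v $ j) * var_x + const (v $ (j + 3)) * var_y" for v :: "'a vec"
      and j
  have Q: "Q \<in> carrier_mat 6 6" by (simp add: Q_def)
  have "g c \<in> R_piece (int 5) 0" for c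
    using R_piece_mult[OF R_piece_s R_piece_gens(2)] R_piece_mult[OF R_piece_s R_piece_gens(3)]
    by (auto simp: g_def)
  note g = R_piece_binary[OF this]
  have key: "dot s (L v) = (\<Sum>e\<le>5. const ((Q *\<^sub>v v) $ e) * var_x ^ e * var_y ^ (5 - e))" if v:
      "v \<in> carrier_vec 6" for v
  proof -
    have 6: "{0..<6} = {0, 1, 2, 3, 4, 5::nat}" by auto
    have "dot s (L v) = (\<Sum>c\<in>{0..<6}. const (v $ c) * g c)"
      unfolding 6 by (simp add: dot_def L_def g_def algebra_simps One_nat_def)
    also have "\<dots> = (\<Sum>c\<in>{0..<6}. \<Sum>e\<le>5. const (Poly_Mapping.lookup (g c) (e, 5
        - e, 0, 0) * v $ c) * var_x ^ e * var_y ^ (5 - e))"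
      by (subst g) (simp add: sum_distrib_left const_mult ac_simps)
    also have "\<dots> = (\<Sum>e\<le>5. \<Sum>c\<in>{0..<6}. const (Poly_Mapping.lookup (g c) (e, 5
        - e, 0, 0) * v $ c) * var_x ^ e * var_y ^ (5 - e))"
      by (rule sum.swap)
    also have "\<dots> = (\<Sum>e\<le>5. const ((Q *\<^sub>v v) $ e) * var_x ^ e * var_y ^ (5 - e))"
      using v by (intro sum.cong) (auto simp: Q_def scalar_prod_def const_sum sum_distrib_right)
    finally show ?thesis .
  qed
  have "det Q \<noteq> 0"
  proof
    assume "det Q = 0"
    then obtain v where v: "v \<in> carrier_vec 6" "v \<noteq> 0\<^sub>v 6" "Q *\<^sub>v v = 0\<^sub>v 6"
      using det_0_iff_vec_prod_zero_field[OF Q] by blast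
    \<comment> \<open>A kernel vector of \<open>Q\<close> is a linear syzygy of \<open>s\<close>,
      hence a combination of the quadrics \<open>A\<close> and \<open>B\<close>, whose part of
      degree 1 is 0.\<close>
    have "dot s (L v) = 0" unfolding key[OF v(1)] v(3) by (simp add: sum.neutral)
    then obtain f h where fh: "\<And>i. i < 3 \<Longrightarrow> L v i = f * A i + h * B i"
      using relation_s_in_AB by metis
    have L1: "xhom 1 (L v i)" for i
      unfolding L_def by (intro xhom_add xhom_mult[OF xhom_const xhom_x]
          xhom_mult[OF xhom_const xhom_y]) auto
    have "L v i = 0" if "i < 3" for i
    proof -
      have "L v i = xpart 1 (f * A i + h * B i)"
        using xpart_xhom[OF L1, of 1 i] unfolding fh[OF that] by simp
      then show ?thesis by (simp add: xpart_add xpart_mult_right[OF xhom_A]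
          xpart_mult_right[OF xhom_B])
    qed
    then have "var_x * const (v $ i) + var_y * const (v $ (i + 3)) = 0" if "i < 3" for i
      using that by (simp add: L_def mult.commute)
    from xhom_0_linear_eq_0[OF xhom_const xhom_const this] have vi: "v $ i = 0" "v $ (i + 3) = 0"
        if "i < 3" for i
      using that by simp_all
    have "v $ i = 0" if "i < 6" for i
      using vi(1)[of i] vi(2)[of "i - 3"] that by (cases "i < 3") auto
    then have "v = 0\<^sub>v 6" using v(1) by (intro eq_vecI) auto
    with v show False by blast
  qed
  \<comment> \<open>Column \<open>i\<close> of the inverse of \<open>Q\<close>.\<close>
  define v where "v = (1 / det Q) \<cdot>\<^sub>v (adj_mat Q *\<^sub>v unit_vec 6 i)"
  have v: "v \<in> carrier_vec 6" using adj_mat(1)[OF Q] by (auto simp: v_def)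
  have "Q *\<^sub>v v = (1 / det Q) \<cdot>\<^sub>v (Q *\<^sub>v (adj_mat Q *\<^sub>v unit_vec 6 i))"
    unfolding v_def using Q adj_mat(1)[OF Q] by (intro mult_mat_vec) auto
  also have "Q *\<^sub>v (adj_mat Q *\<^sub>v unit_vec 6 i) = (Q * adj_mat Q) *\<^sub>v unit_vec 6 i"
    using Q adj_mat(1)[OF Q] by (intro assoc_mult_mat_vec[symmetric]) auto
  also have "(1 / det Q) \<cdot>\<^sub>v ((Q * adj_mat Q) *\<^sub>v unit_vec 6 i) = unit_vec 6 i"
    unfolding adj_mat(2)[OF Q] using \<open>det Q \<noteq> 0\<close>
    by (intro eq_vecI) (auto simp: scalar_prod_left_unit[where n = 6])
  finally have "Q *\<^sub>v v = unit_vec 6 i" .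
  then have "dot s (L v) = (\<Sum>e\<le>5. const (if e = i then 1 else 0) * var_x ^ e * var_y ^ (5 - e))"
    using assms by (subst key[OF v]) (auto intro!: sum.cong)
  also have "\<dots> = (\<Sum>e\<le>5. if e = i then var_x ^ e * var_y ^ (5 - e) else 0)"
    by (intro sum.cong) auto
  also have "\<dots> = var_x ^ i * var_y ^ (5 - i)" using assms by simp
  finally show ?thesis by metis
qed

text \<open>\<open>f\<close> lies in (x, y)^5, whose monomial generators are in the ideal of
  \<open>s\<close>.\<close>

lemma in_ideal_s:
  assumes "\<And>d. d < 5 \<Longrightarrow> xpart d f = 0"
  shows "\<exists>k. f = dot s k"
proof -
  have "\<exists>k. f - (\<Sum>d<5. xpart d f) = dot s k"
  proof (rule xy_power_ideal[where J = "\<lambda>f. \<exists>k. f = dot s k"])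
    fix f g assume "\<exists>k. f = dot s k" "\<exists>k. g = dot s k"
    then obtain k k' where "f = dot s k" "g = dot s k'" by blast
    then show "\<exists>k. f + g = dot s k"
      by (intro exI[of _ "\<lambda>i. k i + k' i"]) (simp add: dot_def algebra_simps)
  next
    fix f g assume "\<exists>k. f = dot s k"
    then obtain k where "f = dot s k" by blast
    then show "\<exists>k. f * g = dot s k"
      by (intro exI[of _ "\<lambda>i. k i * g"]) (simp add: dot_def algebra_simps)
  next
    fix i :: nat assume "i \<le> 5"
    then show "\<exists>k. var_x ^ i * var_y ^ (5 - i) = dot s k" by (rule xy_quintics_in_ideal_s)
  qed
  then show ?thesis using assms by simp
qed

lemma syzygy_xdeg_ge_3:
  assumes "\<And>d i. d < 3 \<Longrightarrow> xpart d (u i) = 0" "dot p u = 0"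
  shows "\<exists>t k. \<forall>i<3. u i = t * s i + cross p k i"
proof -
  have "dot p u = var_z * dot A u + var_w * dot B u"
    by (simp add: dot_def p_def algebra_simps)
  then have "var_w * (- dot B u) = var_z * dot A u"
    using assms(2) by (simp add: eq_neg_iff_add_eq_0 neg_eq_iff_add_eq_0 add.commute)
  then obtain t where t: "- dot B u = var_z * t" "dot A u = var_w * t"
    by (rule mult_w_eq_mult_z)
  \<comment> \<open>\<open>u\<close> starts in degree 3 and \<open>A\<close> has degree 2, so
    \<open>w t\<close> starts in degree 5.\<close>
  have "xpart d t = 0" if "d < 5" for d
  proof -
    have "var_w * xpart d t = xpart d (dot A u)"
      unfolding t(2) by (simp add: xpart_mult[OF xhom_w])
    also have "\<dots> = 0"
      using that assms(1) by (simp add: xpart_dot[OF xhom_A]) (simp add: dot_def)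
    finally show ?thesis by simp
  qed
  then obtain k where k: "t = dot s k" using in_ideal_s by blast
  have sub: "dot v (\<lambda>i. u i - cross p k i) = dot v u - dot v (cross p k)" for v
    by (simp add: dot_def algebra_simps del: cross_simps)
  have "dot A (\<lambda>i. u i - cross p k i) = 0"
    unfolding sub dot_A_cross_p t(2) k by simp
  moreover have "dot B (\<lambda>i. u i - cross p k i) = 0"
    unfolding sub dot_B_cross_p using t(1) k by (simp add: neg_eq_iff_add_eq_0)
  ultimately obtain t' where "\<forall>i<3. u i - cross p k i = t' * s i"
    using kernel_AB by blast
  then show ?thesis by (intro exI2[of _ t' k]) (simp add: diff_eq_eq)
qed

section \<open>Exactness in terms of coefficients\<close>

lemma exact_at_F0:
  assumes "dot p v = 0"
  shows "\<exists>t k n1 n2. \<forall>i<3. v i = t * s i + cross p k i + n1 * N1 i + n2 * N2 i"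
proof -
  have part: "dot p (\<lambda>i. xpart d (v i)) = 0" for d
    using xpart_dot[where u = p and e = 2 and d = "d + 2" and v = v, OF xhom_p] assms by simp
  have v0: "xpart 0 (v i) = 0" if "i < 3" for i
    using syzygy_xdeg_0[OF xhom_xpart part that] .
  obtain f1 g1 where v1: "\<And>i. i < 3 \<Longrightarrow> xpart 1 (v i) = f1 * N1 i + g1 * N2 i"
    using syzygy_xdeg_1[OF xhom_xpart part] by metis
  obtain k2 c where v2: "\<And>i. i < 3 \<Longrightarrow> xpart 2 (v i) = cross p k2 i + c * var_y * N1 i"
    using syzygy_xdeg_2[OF xhom_xpart part] by metis
  let ?u = "\<lambda>i. v i - (xpart 0 (v i) + xpart 1 (v i) + xpart 2 (v i))"
  have "xpart d (?u i) = 0" if "d < 3" for d i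
  proof -
    have "d = 0 \<or> d = 1 \<or> d = 2" using that by linarith
    then show ?thesis by (auto simp: xpart_diff xpart_add xpart_xhom[OF xhom_xpart])
  qed
  moreover have "dot p ?u = dot p v - (dot p (\<lambda>i. xpart 0 (v i)) + dot p (\<lambda>i. xpart 1 (v i))
      + dot p (\<lambda>i. xpart 2 (v i)))"
    by (simp add: dot_def algebra_simps)
  then have "dot p ?u = 0" by (simp add: part assms)
  ultimately obtain t k where tk: "\<And>i. i < 3 \<Longrightarrow> ?u i = t * s i + cross p k i"
    using syzygy_xdeg_ge_3[of ?u] by blast
  have "v i = t * s i + cross p (\<lambda>i. k i + k2 i) i + (f1 + c * var_y) * N1 i + g1 * N2 i" if
      "i < 3" for i
  proof -
    have "v i = ?u i + xpart 0 (v i) + xpart 1 (v i) + xpart 2 (v i)" by simp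
    also have "\<dots> = (t * s i + cross p k i) + 0 + (f1 * N1 i + g1 * N2 i) + (cross p k2 i
        + c * var_y * N1 i)"
      unfolding v0[OF that] v1[OF that] v2[OF that] tk[OF that, unfolded v0[OF that] v1[OF that]
          v2[OF that]] ..
    also have "\<dots> = t * s i + cross p (\<lambda>i. k i + k2 i) i + (f1 + c * var_y) * N1 i + g1 * N2 i"
      by (simp add: cross_def algebra_simps)
    finally show ?thesis .
  qed
  then show ?thesis by blast
qed

text \<open>Up to sign, \<open>(y b1 - x b2, x b1 - y b0)\<close> are the coefficients of
  \<open>N1\<close>, \<open>N2\<close> in a Koszul syzygy by \<open>cross_p_combination\<close>.
  Modulo such pairs the normal form is \<open>(a1 + c y, a2)\<close>.\<close>

lemma reduce_coefficients:
  obtains b0 b1 b2 a1 a2 c where "xhom 0 a1" "xhom 0 a2" "xhom 0 c"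
    "n1 = var_y * b1 - var_x * b2 + a1 + c * var_y" "n2 = var_x * b1 - var_y * b0 + a2"
proof -
  obtain g2 h2 where n2: "n2 = xpart 0 n2 + var_x * g2 + var_y * h2" by (rule decompose_xy)
  obtain g1 h1 where n1: "n1 - var_y * g2 = xpart 0 (n1 - var_y * g2) + var_x * g1 + var_y * h1"
      by (rule decompose_xy)
  obtain g3 h3 where h1: "h1 = xpart 0 h1 + var_x * g3 + var_y * h3" by (rule decompose_xy)
  show ?thesis
  proof (rule that[of "xpart 0 (n1 - var_y * g2)" "xpart 0 n2" "xpart 0 h1"])
    show "xhom 0 (xpart 0 (n1 - var_y * g2))" "xhom 0 (xpart 0 n2)" "xhom 0 (xpart 0 h1)"
        by (rule xhom_xpart)+
    have "n1 = var_y * g2 + (xpart 0 (n1 - var_y * g2) + var_x * g1 + var_y * (xpart 0 h1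
        + var_x * g3 + var_y * h3))"
      unfolding h1[symmetric] n1[symmetric] by simp
    \<comment> \<open>\<open>b1 = g2 + y h3\<close> absorbs \<open>x g2\<close> in \<open>n2\<close>
      and \<open>y^2 h3\<close> in \<open>n1\<close>. Its effect \<open>y g2\<close> on
      \<open>n1\<close> was subtracted beforehand, and \<open>xy h3\<close> in \<open>n2\<close> is
      cancelled by \<open>b0\<close>.\<close>
    then show "n1 = var_y * (g2 + var_y * h3) - var_x * (- g1 - var_y * g3) + xpart 0 (n1
        - var_y * g2) + xpart 0 h1 * var_y"
      by (simp add: algebra_simps)
    show "n2 = var_x * (g2 + var_y * h3) - var_y * (var_x * h3 - h2) + xpart 0 n2"
      by (subst n2) (simp add: algebra_simps)
  qed
qed

lemma p_nonzero: "\<exists>j<3. p j \<noteq> 0"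
proof (rule ccontr)
  assume "\<not> ?thesis"
  then have "\<forall>j<3. eval_R (p j) 1 0 1 0 = 0" by (simp add: eval_R_simps)
  then show False using base_point_free unfolding base_point_free_def
      by (metis Pair_inject zero_neq_one)
qed

text \<open>Known relations bring the coefficients to normal form. The parts of degree 1 and 2 in x,
  y and then the restriction to z = w = 0 kill all of them except \<open>k'\<close>, which turns out
  to be a combination of \<open>A\<close> and \<open>B\<close>.\<close>

lemma exact_at_F1:
  assumes "\<And>i. i < 3 \<Longrightarrow> t * s i + cross p k i + n1 * N1 i + n2 * N2 i = 0"
  shows "\<exists>b0 b1 b2 f g. t = var_w * f - var_z * g \<and>
     (\<forall>i<3. k i = b0 * r 0 i + b1 * r 1 i + b2 * r 2 i + f * A i + g * B i) \<and>
     n1 = var_y * b1 - var_x * b2 \<and> n2 = var_x * b1 - var_y * b0"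
proof -
  obtain b0 b1 b2 a1 a2 c where x: "xhom 0 a1" "xhom 0 a2" "xhom 0 c" and
    n: "n1 = var_y * b1 - var_x * b2 + a1 + c * var_y" "n2 = var_x * b1 - var_y * b0 + a2"
    by (rule reduce_coefficients)
  \<comment> \<open>The representative of \<open>t\<close> modulo z and w; the difference has the
    form \<open>w f0 - z g0\<close> and is absorbed by \<open>A\<close> and
    \<open>B\<close>.\<close>
  let ?t = "subst const var_x var_y 0 0 t"
  obtain f0 g0 where t: "t = ?t + (var_w * f0 - var_z * g0)"
  proof -
    obtain q1 q2 q3 q4 where "t - ?t = (var_x - var_x) * q1 + (var_y - var_y) * q2 + (var_z
        - 0) * q3 + (var_w - 0) * q4"
      using diff_subst by blast
    then show ?thesis by (intro that[of q4 "- q3"]) (simp add: algebra_simps)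
  qed
  define k' where "k' i = k i - (b0 * r 0 i + b1 * r 1 i + b2 * r 2 i) - (f0 * A i
      + g0 * B i)" for i
  have k': "cross p k' i = cross p k i - cross p (\<lambda>i. b0 * r 0 i + b1 * r 1 i + b2 * r 2 i) i
      - (f0 * cross p A i + g0 * cross p B i)" for i
    by (simp add: cross_def k'_def algebra_simps)
  have E: "s i * ?t + cross p k' i + a1 * N1 i + a2 * N2 i + c * var_y * N1 i = 0" if "i < 3" for i
  proof -
    have "s i * ?t + cross p k' i + a1 * N1 i + a2 * N2 i + c * var_y * N1 i = t * s i
        + cross p k i + n1 * N1 i + n2 * N2 i"
      unfolding k' cross_p_combination cross_p_A cross_p_B n
      by (subst (2) t) (simp add: algebra_simps)
    then show ?thesis using assms[OF that] by simp
  qed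
  \<comment> \<open>In degree 1 nothing else contributes: \<open>s\<close> has degree 4, and
    \<open>p\<close> and \<open>y N1\<close> have degree 2.\<close>
  have "a1 * N1 i + a2 * N2 i = 0" if "i < 3" for i
  proof -
    have "xpart 1 (s i * ?t + cross p k' i + a1 * N1 i + a2 * N2 i + c * var_y * N1 i) = a1 * N1 i
        + a2 * N2 i"
      using x by (simp add: xpart_add xpart_mult[OF xhom_s] xpart_cross[OF xhom_p]
          xpart_mult_right[OF xhom_N1]
          xpart_mult_right[OF xhom_N2] xpart_mult_right[OF xhom_y] xpart_xhom[of 0])
    then show ?thesis using E[OF that] by simp
  qed
  then have "dot v (\<lambda>i. a1 * N1 i + a2 * N2 i) = 0" for v by (simp add: dot_def)
  moreover have "dot v (\<lambda>i. a1 * N1 i + a2 * N2 i) = var_y * (a1 * dot v (adj 0)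
      + a2 * dot v (adj 1)) - var_x * (a1 * dot v (adj 1) + a2 * dot v (adj 2))" for v
    by (simp add: dot_def N1_def N2_def algebra_simps del: adj_simps)
  ultimately have "var_y * (a1 * dot v (adj 0) + a2 * dot v (adj 1)) - var_x * (a1 * dot v (adj 1)
      + a2 * dot v (adj 2)) = 0" for v
    by metis
  from this[of "r 0"] this[of "r 1"] have a: "a1 = 0" "a2 = 0"
    using D_nonzero by (simp_all add: dot_r_adj del: adj_simps)
  \<comment> \<open>In degree 2 only the part of \<open>k'\<close> free of x and y meets the term
    with \<open>c\<close>.\<close>
  have E2: "cross p (\<lambda>j. xpart 0 (k' j)) i + c * var_y * N1 i = 0" if "i < 3" for i
  proof -
    have "xpart 2 (s i * ?t + cross p k' i + a1 * N1 i + a2 * N2 i + c * var_y * N1 i)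
        = cross p (\<lambda>j. xpart 0 (k' j)) i + c * var_y * N1 i"
      using x by (simp add: a xpart_add xpart_mult[OF xhom_s] xpart_cross[OF xhom_p]
          xpart_mult_right[OF xhom_N1]
          xpart_mult_right[OF xhom_y] xpart_xhom[of 0])
    then show ?thesis using E[OF that] by simp
  qed
  let ?k = "\<lambda>j. xpart 0 (k' j)"
  have xk: "xhom 0 (cross (r j) ?k i)" for i j
    by (rule xhom_cross_r) (simp add: xhom_xpart)
  have xa: "xhom 0 (c * adj j i)" for i j
    using xhom_mult[OF x(3) xhom_adj] by simp
  have "cross (r 1) ?k i - c * adj 1 i = 0" if "i < 3" for i
  proof -
    have "var_x ^ 2 * cross (r 0) ?k i + var_x * var_y * (cross (r 1) ?k i - c * adj 1 i)
        + var_y ^ 2 * (cross (r 2) ?k i + c * adj 0 i) = 0"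
      using E2[OF that] by (simp add: cross_p N1_def power2_eq_square algebra_simps del:
          cross_simps adj_simps)
    from xhom_0_quadratic_eq_0(2)[OF xk xhom_diff[OF xk xa] xhom_add[OF xk xa] this] show ?thesis .
  qed
  then have "dot (r 1) (\<lambda>i. cross (r 1) ?k i - c * adj 1 i) = 0"
      by (simp add: dot_def del: cross_simps adj_simps)
  moreover have "dot (r 1) (\<lambda>i. cross (r 1) ?k i - c * adj 1 i) = dot (r 1) (cross (r 1) ?k)
      - c * dot (r 1) (adj 1)"
    by (simp add: dot_def algebra_simps del: cross_simps adj_simps)
  ultimately have c: "c = 0"
    using D_nonzero by (simp add: dot_cross dot_r_adj del: adj_simps)
  have E3: "s i * ?t + cross p k' i = 0" if "i < 3" for i
    using E[OF that] by (simp add: a c)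
  \<comment> \<open>At z = w = 0 the vector \<open>p\<close> vanishes, while \<open>s\<close>, free
    of z and w, is unchanged.\<close>
  have t0: "?t = 0"
  proof -
    have "s i * ?t = 0" if "i < 3" for i
    proof -
      have "subst const var_x var_y 0 0 (s i * ?t + cross p k' i) = s i * ?t"
        by (auto simp: subst_const_simps subst_subst cross_def p_def s_def A_def B_def)
      then show ?thesis using E3[OF that] by (simp add: subst_const_simps)
    qed
    then show ?thesis using s_nonzero by (metis mult_eq_0_iff)
  qed
  have pk: "cross p k' i = 0" if "i < 3" for i using E3[OF that] t0 by simp
  \<comment> \<open>The product with \<open>A\<close> is w times \<open>dot s k'\<close>, so
    \<open>k'\<close> is a syzygy of \<open>s\<close>.\<close>
  have "dot A (cross p k') = 0" unfolding dot_def using pk by (simp del: cross_simps)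
  then have "dot s k' = 0" by (simp add: dot_A_cross_p)
  then obtain f g where fg: "\<And>i. i < 3 \<Longrightarrow> k' i = f * A i + g * B i"
    using relation_s_in_AB by metis
  have "s i * (var_w * f - var_z * g) = 0" if "i < 3" for i
  proof -
    have "cross p k' i = cross p (\<lambda>i. f * A i + g * B i) i"
      using fg by (simp add: cross_def)
    also have "\<dots> = f * cross p A i + g * cross p B i"
      by (simp add: cross_def algebra_simps)
    also have "\<dots> = - (s i * (var_w * f - var_z * g))"
      unfolding cross_p_A cross_p_B by (simp add: algebra_simps)
    finally show ?thesis using pk[OF that] by simp
  qed
  \<comment> \<open>Hence adding \<open>f\<close> and \<open>g\<close> to \<open>f0\<close> and
    \<open>g0\<close> leaves \<open>t\<close> unchanged.\<close>
  then have wz: "var_w * f = var_z * g" using s_nonzero by (metis mult_eq_0_iff right_minus_eq)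
  show ?thesis
  proof (intro exI conjI allI impI)
    show "t = var_w * (f0 + f) - var_z * (g0 + g)"
      using t t0 wz by (simp add: algebra_simps)
    show "k i = b0 * r 0 i + b1 * r 1 i + b2 * r 2 i + (f0 + f) * A i + (g0 + g) * B i" if
        "i < 3" for i
      using fg[OF that] by (simp add: k'_def algebra_simps)
    show "n1 = var_y * b1 - var_x * b2" "n2 = var_x * b1 - var_y * b0"
      using n a c by simp_all
  qed
qed

text \<open>The \<open>b\<close> are a multiple \<open>u\<close> of (x^2, xy, y^2) and (f, g) is a
  multiple \<open>t\<close> of (z, w). The remaining equations then read
  \<open>p i * (u + t) = 0\<close>.\<close>

lemma exact_at_F2:
  assumes "var_w * f - var_z * g = 0"
    and k: "\<And>i. i < 3 \<Longrightarrow> b0 * r 0 i + b1 * r 1 i + b2 * r 2 i + f * A i + g * B i = 0"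
    and b: "var_y * b1 - var_x * b2 = 0" "var_x * b1 - var_y * b0 = 0"
  shows "\<exists>u. b0 = var_x ^ 2 * u \<and> b1 = var_x * var_y * u \<and> b2 = var_y ^ 2 * u \<and> f = - (var_z * u)
      \<and> g = - (var_w * u)"
proof -
  have "var_x * b1 = var_y * b0" using b by simp
  then obtain t' where t': "b1 = var_y * t'" "b0 = var_x * t'" by (rule mult_x_eq_mult_y)
  have "var_x * b2 = var_y * (var_y * t')" using b t' by simp
  then obtain t'' where t'': "b2 = var_y * t''" "var_y * t' = var_x * t''"
      by (rule mult_x_eq_mult_y)
  from t''(2)[symmetric] obtain u where u: "t'' = var_y * u" "t' = var_x * u"
      by (rule mult_x_eq_mult_y)
  have "var_w * f = var_z * g" using assms(1) by simp
  then obtain t where t: "f = var_z * t" "g = var_w * t" by (rule mult_w_eq_mult_z)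
  have "p i * (u + t) = 0" if "i < 3" for i
  proof -
    have "p i * (u + t) = b0 * r 0 i + b1 * r 1 i + b2 * r 2 i + f * A i + g * B i"
      unfolding t' t'' u t by (simp add: distrib_left) (simp add: p_eq p_def[symmetric]
          algebra_simps power2_eq_square, simp add: p_def A_def B_def r_def algebra_simps
          power2_eq_square)
    then show ?thesis using k[OF that] by simp
  qed
  then have "u + t = 0" using p_nonzero by (metis mult_eq_0_iff)
  then have "t = - u" by (simp add: eq_neg_iff_add_eq_0 add.commute)
  then show ?thesis using t' t'' u t by (intro exI[of _ u]) (simp add: power2_eq_square)
qed

end

section \<open>The generic case and the determinant\<close>

lemma alg_closed_infinite: "infinite (UNIV :: 'k::alg_closed_field set)"
proof
  assume fin: "finite (UNIV :: 'k set)"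
  \<comment> \<open>\<open>q\<close> vanishes at every element of the field, so \<open>q + 1\<close>
    has no root.\<close>
  define q where "q = (\<Prod>a\<in>(UNIV :: 'k set). [:- a, 1:])"
  have "degree q = card (UNIV :: 'k set)" unfolding q_def by (subst degree_prod_eq_sum_degree) auto
  then have "degree (q + 1) > 0"
    using fin by (subst degree_add_eq_left) (auto simp: card_gt_0_iff)
  then obtain c where "poly (q + 1) c = 0" using alg_closed_imp_poly_has_root by blast
  moreover have "poly q c = 0" using fin by (simp add: q_def poly_prod)
  ultimately show False by simp
qed

context quadric_pencil
begin

text \<open>At a root (x, y) of \<open>s j\<close>, the values of \<open>A\<close> and
  \<open>B\<close> are orthogonal to \<open>u\<close>, so those of \<open>s\<close> are proportional
  to \<open>u\<close>. If \<open>u j\<close> were nonzero, all of them would vanish.\<close>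

lemma no_constant_syzygy:
  assumes "base_point_free" "\<forall>i<3. dot (a i) u = 0" "\<forall>i<3. dot (b i) u = 0" "j < 3"
  shows "u j = 0"
proof (rule ccontr)
  assume uj: "u j \<noteq> 0"
  obtain e where e: "s j = (\<Sum>i\<le>4. const (e i) * var_x ^ i * var_y ^ (4 - i))"
    using R_piece_binary[of "s j" 4] R_piece_s[of j] by auto
  obtain x y where xy: "(x, y) \<noteq> (0, 0)" "(\<Sum>i\<le>4. e i * x ^ i * y ^ (4 - i)) = 0"
    using binary_form_has_root[of 4 e] by auto
  have "eval_R (s j) x y 0 0 = 0" unfolding e using xy(2) by (simp add: eval_R_simps)
  let ?A = "\<lambda>j. eval_R (A j) x y 0 0" and ?B = "\<lambda>j. eval_R (B j) x y 0 0"
  have "dot ?A u = x ^ 2 * dot (a 0) u + x * y * dot (a 1) u + y ^ 2 * dot (a 2) u"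
     "dot ?B u = x ^ 2 * dot (b 0) u + x * y * dot (b 1) u + y ^ 2 * dot (b 2) u"
    by (simp_all add: A_def B_def dot_def eval_R_simps algebra_simps)
  then have AB: "dot ?A u = 0" "dot ?B u = 0" using assms(2,3) by simp_all
  have "\<forall>i<3. \<forall>j<3. cross ?A ?B i * u j = cross ?A ?B j * u i"
    unfolding all_less_3 using AB by (simp add: dot_def) (intro conjI; Groebner_Basis.algebra)
  moreover have "cross ?A ?B j = 0"
    using \<open>eval_R (s j) x y 0 0 = 0\<close> by (simp add: s_def cross_def eval_R_simps split: if_splits)
  ultimately have "\<forall>i<3. cross ?A ?B i = 0" using uj assms(4) by (metis mult_eq_0_iff)
  then show False using s_eval_nonzero[OF assms(1) xy(1)] by blast
qed

text \<open>\<open>r\<close> is singular at (c, 1), and a nonzero column \<open>u\<close> of the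
  adjugate there lies in its kernel. Then the combination of the \<open>p j\<close> with weights
  \<open>u\<close> is \<open>(z - c w) q\<close> with \<open>q = A u\<close>. The condition with
  \<open>subst\<close> records that \<open>q\<close> is free of z and w.\<close>

lemma linear_factor_in_plane:
  assumes "base_point_free" "D = 0"
  obtains q where "q \<in> R_piece 2 0" "q \<noteq> 0" "\<And>f. subst const var_x var_y (const f) 1 q = q"
    "q * (var_z - const c * var_w) \<in> k_span {p 0, p 1, p 2}"
proof -
  have "dot (r_at c 1 0) (adj_at c 1 0) = eval_R D 0 0 c 1"
    by (simp add: D_def dot_def r_at_def adj_at_def r_def eval_R_simps)
  then have D0: "dot (r_at c 1 0) (adj_at c 1 0) = 0" using assms(2) by (simp add: eval_R_simps)
  obtain j where j: "j < 3" "\<exists>i<3. adj_at c 1 j i \<noteq> 0"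
    using adj_at_nonzero[OF assms(1), of c 1] by auto
  define u where "u = adj_at c 1 j"
  have "\<forall>i<3. \<forall>j<3. dot (r_at c 1 i) (adj_at c 1 j) = (if i
      = j then dot (r_at c 1 0) (adj_at c 1 0) else 0)"
    unfolding all_less_3 by (simp add: dot_def adj_at_def algebra_simps)
  then have "dot (r_at c 1 i) u = (if i = j then dot (r_at c 1 0) (adj_at c 1 0) else 0)" if
      "i < 3" for i
    unfolding u_def using that j(1) by blast
  then have "dot (r_at c 1 i) u = 0" if "i < 3" for i
    using that unfolding D0 by simp
  moreover have "dot (r_at c 1 i) u = c * dot (a i) u + dot (b i) u" for i
    by (simp add: dot_def r_at_def algebra_simps)
  ultimately have b: "dot (b i) u = - c * dot (a i) u" if "i < 3" for i
    using that by (metis add.commute add_eq_0_iff mult_minus_left)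
  define q where "q = var_x ^ 2 * const (dot (a 0) u) + var_x * var_y * const (dot (a 1) u)
      + var_y ^ 2 * const (dot (a 2) u)"
  have q: "q \<in> R_piece 2 0"
    using R_piece_mult[OF R_piece_mult[OF R_piece_gens(2,2)] R_piece_gens(1)] R_piece_mult[OF
        R_piece_mult[OF R_piece_gens(2,3)] R_piece_gens(1)]
      R_piece_mult[OF R_piece_mult[OF R_piece_gens(3,3)] R_piece_gens(1)]
    by (auto simp: q_def power2_eq_square intro!: R_piece_add)
  have "q \<noteq> 0"
  proof
    assume "q = 0"
    then have "const (dot (a 0) u) = 0 \<and> const (dot (a 1) u) = 0 \<and> const (dot (a 2) u) = 0"
      unfolding q_def using xhom_0_quadratic_eq_0[OF xhom_const xhom_const xhom_const] by metis
    then have "\<forall>i<3. dot (a i) u = 0" unfolding all_less_3 by simp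
    then show False using no_constant_syzygy[OF assms(1), of u] b j(2) unfolding u_def by auto
  qed
  have "q * (var_z - const c * var_w) = var_z * q + var_w * (var_x ^ 2 * const (- c * dot (a 0) u)
      + var_x * var_y * const (- c * dot (a 1) u) + var_y ^ 2 * const (- c * dot (a 2) u))"
    by (simp add: q_def const_mult const_uminus algebra_simps)
  also have "\<dots> = var_z * q + var_w * (var_x ^ 2 * const (dot (b 0) u)
      + var_x * var_y * const (dot (b 1) u) + var_y ^ 2 * const (dot (b 2) u))"
    using b by simp
  also have "\<dots> = const (u 0) * p 0 + const (u 1) * p 1 + const (u 2) * p 2"
    by (simp add: q_def p_def A_def B_def dot_def const_add const_mult algebra_simps)
  also have "\<dots> \<in> k_span {p 0, p 1, p 2}"
    by (intro Modules.module.span_add[OF module_R_scale] Modules.module.span_scale[OF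
        module_R_scale] Modules.module.span_base[OF module_R_scale]) auto
  finally have "q * (var_z - const c * var_w) \<in> k_span {p 0, p 1, p 2}" .
  moreover have "subst const var_x var_y (const f) 1 q = q" for f
    by (simp add: q_def subst_const_simps)
  ultimately show ?thesis using q \<open>q \<noteq> 0\<close> that by blast
qed

text \<open>If \<open>D\<close> were 0, each \<open>c\<close> in the infinite field would give its
  own point of the intersection with the Segre image.\<close>

lemma D_nonzero_if_generic:
  assumes "base_point_free" "generic_case (p 0) (p 1) (p 2)"
  shows "D \<noteq> 0"
proof
  assume "D = 0"
  define good where "good c q \<longleftrightarrow> q \<in> R_piece 2 0 \<and> q \<noteq> 0
      \<and> (\<forall>f. subst const var_x var_y (const f) 1 q = q) \<and>
    q * (var_z - const c * var_w) \<in> k_span {p 0, p 1, p 2}" for c and q :: "'k R"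
  have "\<exists>q. good c q" for c
    unfolding good_def by (rule linear_factor_in_plane[OF assms(1) \<open>D = 0\<close>, of c]) blast
  then obtain q where q: "\<And>c. good c (q c)" by metis
  have lin: "var_z - const c * var_w \<noteq> (0 :: 'k R)" for c
    using linear_form_nonzero[of "var_z - const c * var_w"] by (auto simp: linear_forms_def)
  let ?E = "\<lambda>c. k_span {q c * (var_z - const c * var_w)}"
  have "?E c \<in> W_plane (p 0) (p 1) (p 2) \<inter> segre_image" for c
  proof
    show "?E c \<in> W_plane (p 0) (p 1) (p 2)"
      using q[of c] lin[of c] unfolding good_def W_plane_def projectivization_def by auto
    have "var_z - const c * var_w \<in> R_piece 0 1"
      using R_piece_mult[OF R_piece_gens(1) R_piece_gens(5)] by (auto
          intro!: R_piece_diff R_piece_gens)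
    then show "?E c \<in> segre_image"
      using q[of c] lin[of c] unfolding good_def segre_image_def by blast
  qed
  then have "finite (range ?E)"
    using assms(2) finite_subset[of "range ?E"] unfolding generic_case_def by blast
  moreover have "inj ?E"
  proof (rule injI)
    fix c d assume "?E c = ?E d"
    then have "q c * (var_z - const c * var_w) \<in> ?E d"
      using Modules.module.span_base[OF module_R_scale] by blast
    then obtain t where t: "q c * (var_z - const c * var_w) = const t * (q d * (var_z
        - const d * var_w))"
      by (auto simp: Modules.module.span_singleton[OF module_R_scale])
    \<comment> \<open>Setting z = d and w = 1 kills the generator for \<open>d\<close> and
      multiplies \<open>q c\<close> by \<open>d - c\<close>.\<close>
    have "subst const var_x var_y (const d) 1 (q c * (var_z - const c * var_w)) = 0"
      unfolding t by (simp add: subst_const_simps)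
    then have "q c * (const d - const c) = 0"
      using q[of c] by (simp add: subst_const_simps good_def)
    then have "const (d - c) = (0 :: 'k R)" using q[of c] by (simp add: good_def const_diff)
    then show "c = d" by simp
  qed
  ultimately show False
    using alg_closed_infinite finite_imageD by blast
qed

end

section \<open>The resolution\<close>

text \<open>\<open>f\<close> vanishes at the origin, and \<open>diff_subst\<close> there writes it
  as a combination of the variables.\<close>

lemma R_piece_in_max_ideal:
  fixes f :: "'k::field R"
  assumes "f \<in> R_piece m n" "(m, n) \<noteq> (0, 0)"
  shows "f \<in> max_ideal"
proof -
  have "eval_R f 0 0 0 0 = 0"
    unfolding eval_R_def
  proof (intro sum.neutral ballI)
    fix t assume "t \<in> Poly_Mapping.keys f"
    moreover obtain i j k l where t: "t = (i, j, k, l)" by (cases t)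
    ultimately have "int (i + j) = m" "int (k + l) = n" using assms(1) by (force simp: R_piece_def)+
    then have "i \<noteq> 0 \<or> j \<noteq> 0 \<or> k \<noteq> 0 \<or> l \<noteq> 0" using assms(2) by auto
    then show "(case t of (i, j, k, l) \<Rightarrow> Poly_Mapping.lookup f (i, j, k, l) * 0 ^ i * 0 ^ j * 0 ^
        k * 0 ^ l) = 0"
      unfolding t by auto
  qed
  then have "subst const 0 0 0 0 f = 0"
    using subst_const_consts[of 0 0 0 0 f] by simp
  then obtain q1 q2 q3 q4 where f: "f = q1 * var_x + q2 * var_y + q3 * var_z + q4 * var_w"
    using diff_subst[of f 0 0 0 0] by (auto simp: mult.commute)
  show ?thesis unfolding f max_ideal_def
    by (intro Modules.module.span_add[OF module_R_times] Modules.module.span_scale[OF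
        module_R_times] Modules.module.span_base[OF module_R_times]) auto
qed

text \<open>A graded map from \<open>R(c)\<close> to \<open>R(c')\<close> is multiplication by a
  form of bidegree \<open>c' - c\<close>; this allows gradedness to be checked entry by
  entry.\<close>

definition homogeneous_mat :: "twists \<Rightarrow> twists \<Rightarrow> 'k::comm_ring_1 R mat \<Rightarrow> bool" where
  "homogeneous_mat F G M \<longleftrightarrow> M \<in> carrier_mat (length G) (length F) \<and>
     (\<forall>i<length G. \<forall>j<length F. M $$ (i, j) \<in> R_piece (fst (G ! i) - fst (F ! j)) (snd (G ! i)
         - snd (F ! j)))"

lemma mult_mat_vec_nth:
  assumes "M \<in> carrier_mat n m" "v \<in> carrier_vec m" "i < n"
  shows "(M *\<^sub>v v) $ i = (\<Sum>j<m. M $$ (i, j) * v $ j)"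
  using assms by (auto simp: scalar_prod_def lessThan_atLeast0 intro!: sum.cong)

lemma homogeneous_mat_hom: "homogeneous_mat F G M \<Longrightarrow> bigraded_hom F G M"
  unfolding homogeneous_mat_def bigraded_hom_def
proof (elim conjE, intro conjI allI ballI)
  fix m n and v :: "'a R vec"
  assume M: "M \<in> carrier_mat (length G) (length F)" and
    e: "\<forall>i<length G. \<forall>j<length F. M $$ (i, j) \<in> R_piece (fst (G ! i) - fst (F ! j)) (snd (G ! i)
        - snd (F ! j))" and
    v: "v \<in> free_piece F m n"
  have "M $$ (i, j) * v $ j \<in> R_piece (m + fst (G ! i)) (n + snd (G ! i))" if "i < length G"
      "j < length F" for i j
    using R_piece_mult[of "M $$ (i, j)" "fst (G ! i) - fst (F ! j)" "snd (G ! i) - snd (F ! j)"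
        "v $ j" "m + fst (F ! j)" "n + snd (F ! j)"]
      e v that by (simp add: free_piece_def algebra_simps)
  then show "M *\<^sub>v v \<in> free_piece G m n"
    using M v by (auto simp: free_piece_def mult_mat_vec_nth[OF M] simp del: index_mult_mat_vec
        intro!: R_piece_sum)
qed

text \<open>No twist occurs on both sides, so no entry has bidegree (0, 0).\<close>

lemma homogeneous_mat_minimal:
  fixes M :: "'k::field R mat"
  assumes "homogeneous_mat F G M" "set F \<inter> set G = {}" "v \<in> mat_image M" "i < length G"
  shows "v $ i \<in> max_ideal"
proof -
  have M: "M \<in> carrier_mat (length G) (length F)" using assms(1) by (simp add: homogeneous_mat_def)
  obtain u where u: "u \<in> carrier_vec (length F)" "v = M *\<^sub>v u"
    using assms(3) M by (auto simp: mat_image_def)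
  have e: "M $$ (i, j) \<in> max_ideal" if "j < length F" for j
  proof (rule R_piece_in_max_ideal)
    show "M $$ (i, j) \<in> R_piece (fst (G ! i) - fst (F ! j)) (snd (G ! i) - snd (F ! j))"
      using assms(1,4) that by (simp add: homogeneous_mat_def)
    have "G ! i \<noteq> F ! j" using assms(2,4) that by (metis disjoint_iff nth_mem)
    then show "(fst (G ! i) - fst (F ! j), snd (G ! i) - snd (F ! j)) \<noteq> (0, 0)"
      by (simp add: prod_eq_iff)
  qed
  have "u $ j * M $$ (i, j) \<in> max_ideal" if "j < length F" for j
    using e[OF that] unfolding max_ideal_def by (intro Modules.module.span_scale[OF module_R_times])
  then have "(\<Sum>j<length F. M $$ (i, j) * u $ j) \<in> max_ideal"
    unfolding max_ideal_def by (intro Modules.module.span_sum[OF module_R_times]) (simp add: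
        mult.commute)
  then show ?thesis using mult_mat_vec_nth[OF M u(1) assms(4)] u(2) by simp
qed

section \<open>The differentials\<close>

context quadric_pencil
begin

text \<open>
  The columns of \<open>d2\<close> come from the identities for \<open>p \<times> r\<^sub>b\<close> in \<open>cross_p_r\<close>, from \<open>p \<times> A = - w s\<close>
      and
  from \<open>p \<times> B = z s\<close>; the column \<open>d3\<close> from the two expansions of \<open>p\<close> in terms of \<open>r\<close> and of \<open>A, B\<close>.
\<close>

definition d0 :: "'k R mat" where "d0 = mat 1 3 (\<lambda>(i, j). p j)"
text \<open>The columns follow the twists (-6, -1), (-4, -2), (-3, -3): \<open>s\<close>, the Koszul
  syzygies with \<open>e_0\<close>, \<open>e_1\<close>, \<open>e_2\<close>, then \<open>N1\<close>
  and \<open>N2\<close>.\<close>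

definition d1 :: "'k R mat" where
  "d1 = mat 3 6 (\<lambda>(i, j). if j = 0 then s i else if j < 4 then cross p (\<lambda>m. if m = j
      - 1 then 1 else 0) i
     else if j = 4 then N1 i else N2 i)"
definition d2 :: "'k R mat" where
  "d2 = mat 6 5 (\<lambda>(i, j).
     if i = 0 then [0, 0, 0, var_w, - var_z] ! j
     else if i < 4 then [r 0 (i - 1), r 1 (i - 1), r 2 (i - 1), A (i - 1), B (i - 1)] ! j
     else if i = 4 then [0, var_y, - var_x, 0, 0] ! j
     else [- var_y, var_x, 0, 0, 0] ! j)"
definition d3 :: "'k R mat" where
  "d3 = mat 5 1 (\<lambda>(i, j). [var_x ^ 2, var_x * var_y, var_y ^ 2, - var_z, - var_w] ! i)"

lemma d_carrier: "d0 \<in> carrier_mat 1 3" "d1 \<in> carrier_mat 3 6" "d2 \<in> carrier_mat 6 5"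
    "d3 \<in> carrier_mat 5 1"
  by (simp_all add: d0_def d1_def d2_def d3_def)

lemma lessThan_numerals:
  "{..<1} = {0::nat}" "{..<3} = {0, 1, 2::nat}" "{..<5} = {0, 1, 2, 3, 4::nat}" "{..<6}
      = {0, 1, 2, 3, 4, 5::nat}"
  by auto

lemma all_less_numerals:
  "(\<forall>i<1. P i) \<longleftrightarrow> P (0::nat)"
  "(\<forall>i<5. P i) \<longleftrightarrow> P (0::nat) \<and> P 1 \<and> P 2 \<and> P 3 \<and> P 4"
  "(\<forall>i<6. P i) \<longleftrightarrow> P (0::nat) \<and> P 1 \<and> P 2 \<and> P 3 \<and> P 4 \<and> P 5"
  using lessThan_numerals by (auto simp: set_eq_iff One_nat_def)

lemma d0_mult: "v \<in> carrier_vec 3 \<Longrightarrow> (d0 *\<^sub>v v) $ 0 = dot p (($) v)"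
  using mult_mat_vec_nth[OF d_carrier(1), of v 0]
      by (simp add: d0_def dot_def lessThan_numerals del: index_mult_mat_vec)

lemma d1_mult:
  assumes "v \<in> carrier_vec 6" "i < 3"
  shows "(d1 *\<^sub>v v) $ i = v $ 0 * s i + cross p (\<lambda>m. v $ (m + 1)) i + v $ 4 * N1 i + v $ 5 * N2 i"
proof -
  have "\<forall>i<3. (d1 *\<^sub>v v) $ i = v $ 0 * s i + cross p (\<lambda>m. v $ (m + 1)) i + v $ 4 * N1 i
      + v $ 5 * N2 i"
    unfolding all_less_3 using mult_mat_vec_nth[OF d_carrier(2) assms(1)]
    by (simp add: d1_def lessThan_numerals algebra_simps del: index_mult_mat_vec)
  then show ?thesis using assms(2) by blast
qed

lemma d2_mult:
  assumes "v \<in> carrier_vec 5"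
  shows "(d2 *\<^sub>v v) $ 0 = var_w * v $ 3 - var_z * v $ 4"
    "\<forall>i<3. (d2 *\<^sub>v v) $ (i + 1) = v $ 0 * r 0 i + v $ 1 * r 1 i + v $ 2 * r 2 i + v $ 3 * A i
        + v $ 4 * B i"
    "(d2 *\<^sub>v v) $ 4 = var_y * v $ 1 - var_x * v $ 2"
    "(d2 *\<^sub>v v) $ 5 = var_x * v $ 1 - var_y * v $ 0"
  unfolding all_less_3 using mult_mat_vec_nth[OF d_carrier(3) assms]
  by (simp_all add: d2_def lessThan_numerals algebra_simps One_nat_def numeral_2_eq_2 del:
      index_mult_mat_vec)

lemma d3_mult:
  assumes "v \<in> carrier_vec 1"
  shows "d3 *\<^sub>v v = vec 5 (\<lambda>i. [var_x ^ 2, var_x * var_y, var_y ^ 2, - var_z, - var_w] ! i * v $ 0)"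
  using mult_mat_vec_nth[OF d_carrier(4) assms] d_carrier(4)
  by (intro eq_vecI) (simp_all add: d3_def lessThan_numerals del: index_mult_mat_vec)

lemma d0_image: "(\<lambda>v. v $ 0) ` mat_image d0 = ideal_of {p 0, p 1, p 2}"
proof -
  have "(\<lambda>v. v $ 0) ` mat_image d0 = {f. \<exists>v\<in>carrier_vec 3. f = dot p (($) v)}"
    using d_carrier(1) d0_mult by (auto simp: mat_image_def image_iff intro!: bexI)
  also have "\<dots> = {f. \<exists>e0 e1 e2. f = e0 * p 0 + e1 * p 1 + e2 * p 2}"
  proof (intro equalityI subsetI; clarsimp)
    fix v :: "'k R vec"
    show "\<exists>e0 e1 e2. dot p (($) v) = e0 * p 0 + e1 * p 1 + e2 * p 2"
      by (rule exI[of _ "v $ 0"], rule exI[of _ "v $ 1"], rule exI[of _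
          "v $ 2"]) (simp add: dot_def algebra_simps)
  next
    fix e0 e1 e2
    show "\<exists>v\<in>carrier_vec 3. e0 * p 0 + e1 * p 1 + e2 * p 2 = dot p (($) v)"
      by (rule bexI[of _ "vec 3 (\<lambda>i. [e0, e1, e2] ! i)"]) (simp_all add: dot_def algebra_simps)
  qed
  also have "\<dots> = ideal_of {p 0, p 1, p 2}"
    by (auto simp: Modules.module.span_insert[OF module_R_times] Modules.module.span_empty[OF
        module_R_times] algebra_simps eq_diff_eq)
  finally show ?thesis .
qed

end

section \<open>Exactness, degrees and minimality of the complex\<close>

context generic_pencil
begin

lemma kernel_d0: "mat_image d1 = mat_kernel d0"
proof (intro equalityI subsetI)
  fix v assume "v \<in> mat_image d1"
  then obtain u where u: "u \<in> carrier_vec 6" "v = d1 *\<^sub>v u"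
    using d_carrier(2) by (auto simp: mat_image_def)
  have v: "v \<in> carrier_vec 3" using u d_carrier(2) by auto
  have "dot p (($) v) = dot p (\<lambda>i. u $ 0 * s i + cross p (\<lambda>m. u $ (m + 1)) i + u $ 4 * N1 i
      + u $ 5 * N2 i)"
    unfolding u(2) using d1_mult[OF u(1)] by (simp add: dot_def del: index_mult_mat_vec cross_simps)
  also have "\<dots> = u $ 0 * dot p s + dot p (cross p (\<lambda>m. u $ (m + 1))) + u $ 4 * dot p N1
      + u $ 5 * dot p N2"
    by (simp add: dot_def algebra_simps del: cross_simps)
  also have "\<dots> = 0" by (simp add: dot_p_gens)
  finally have "d0 *\<^sub>v v = 0\<^sub>v 1"
    using d0_mult[OF v] d_carrier(1) by (intro eq_vecI) (auto simp del: index_mult_mat_vec)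
  then show "v \<in> mat_kernel d0" using v d_carrier(1) by (auto simp: mat_kernel_def)
next
  fix v assume "v \<in> mat_kernel d0"
  then have v: "v \<in> carrier_vec 3" "d0 *\<^sub>v v = 0\<^sub>v 1" using d_carrier(1)
      by (auto simp: mat_kernel_def)
  then have "dot p (($) v) = 0" using d0_mult[OF v(1)] by simp
  then obtain t k n1 n2 where *: "\<And>i. i < 3 \<Longrightarrow> v $ i = t * s i + cross p k i + n1 * N1 i + n2 * N2 i"
    using exact_at_F0 by metis
  let ?u = "vec 6 (\<lambda>i. [t, k 0, k 1, k 2, n1, n2] ! i)"
  have k: "cross p (\<lambda>m. ?u $ (m + 1)) i = cross p k i" for i
    by (simp add: cross_def)
  have "v = d1 *\<^sub>v ?u"
    using v(1) d_carrier(2) * d1_mult[of ?u] unfolding k by (intro eq_vecI) (auto simp del: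
        index_mult_mat_vec)
  then show "v \<in> mat_image d1" using d_carrier(2) by (auto simp: mat_image_def)
qed

lemma kernel_d1: "mat_image d2 = mat_kernel d1"
proof (intro equalityI subsetI)
  fix v assume "v \<in> mat_image d2"
  then obtain u where u: "u \<in> carrier_vec 5" "v = d2 *\<^sub>v u"
    using d_carrier(3) by (auto simp: mat_image_def)
  have v: "v \<in> carrier_vec 6" using u d_carrier(3) by auto
  have "(d1 *\<^sub>v v) $ i = 0" if "i < 3" for i
  proof -
    have "cross p (\<lambda>m. v $ (m + 1)) i = cross p (\<lambda>i. u $ 0 * r 0 i + u $ 1 * r 1 i + u $ 2 * r 2 i
        + u $ 3 * A i + u $ 4 * B i) i"
      using d2_mult(2)[OF u(1)] unfolding u(2) all_less_3 cross_def by (simp only: )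
    also have "\<dots> = cross p (\<lambda>i. u $ 0 * r 0 i + u $ 1 * r 1 i + u $ 2 * r 2 i) i
        + u $ 3 * cross p A i + u $ 4 * cross p B i"
      by (simp add: cross_def algebra_simps)
    finally have e: "cross p (\<lambda>m. v $ (m + 1)) i = cross p (\<lambda>i. u $ 0 * r 0 i + u $ 1 * r 1 i
        + u $ 2 * r 2 i) i + u $ 3 * cross p A i + u $ 4 * cross p B i" .
    show ?thesis
      unfolding d1_mult[OF v that] e cross_p_combination cross_p_A cross_p_B d2_mult(1,3,4)[OF
          u(1), folded u(2)]
      by (simp add: algebra_simps)
  qed
  then have "d1 *\<^sub>v v = 0\<^sub>v 3"
    using d_carrier(2) by (intro eq_vecI) (auto simp del: index_mult_mat_vec)
  then show "v \<in> mat_kernel d1" using v d_carrier(2) by (auto simp: mat_kernel_def)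
next
  fix v assume "v \<in> mat_kernel d1"
  then have v: "v \<in> carrier_vec 6" "d1 *\<^sub>v v = 0\<^sub>v 3" using d_carrier(2)
      by (auto simp: mat_kernel_def)
  then have "v $ 0 * s i + cross p (\<lambda>m. v $ (m + 1)) i + v $ 4 * N1 i + v $ 5 * N2 i = 0" if
      "i < 3" for i
    using d1_mult[OF v(1) that] that by simp
  from exact_at_F1[OF this] obtain b0 b1 b2 f g where *: "v $ 0 = var_w * f - var_z * g"
     "\<forall>i<3. v $ (i + 1) = b0 * r 0 i + b1 * r 1 i + b2 * r 2 i + f * A i + g * B i"
     "v $ 4 = var_y * b1 - var_x * b2" "v $ 5 = var_x * b1 - var_y * b0"
    by blast
  let ?u = "vec 5 (\<lambda>i. [b0, b1, b2, f, g] ! i)"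
  have u: "?u \<in> carrier_vec 5" by simp
  have "\<forall>i<6. v $ i = (d2 *\<^sub>v ?u) $ i"
    using *(2) d2_mult(2)[OF u] unfolding all_less_numerals all_less_3 d2_mult(1,3,4)[OF u] *(1,3,4)
    by (simp del: index_mult_mat_vec)
  then have "v = d2 *\<^sub>v ?u"
    using v(1) d_carrier(3) by (intro eq_vecI) (auto simp del: index_mult_mat_vec)
  then show "v \<in> mat_image d2" using d_carrier(3) by (auto simp: mat_image_def)
qed

lemma kernel_d2: "mat_image d3 = mat_kernel d2"
proof (intro equalityI subsetI)
  fix v assume "v \<in> mat_image d3"
  then obtain u where u: "u \<in> carrier_vec 1" "v = d3 *\<^sub>v u"
    using d_carrier(4) by (auto simp: mat_image_def)
  have v: "v \<in> carrier_vec 5" using u d_carrier(4) by auto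
  have vi: "v $ 0 = var_x ^ 2 * u $ 0" "v $ 1 = var_x * var_y * u $ 0" "v $ 2 = var_y ^ 2 * u $ 0"
      "v $ 3 = - var_z * u $ 0" "v $ 4 = - var_w * u $ 0"
    unfolding u(2) d3_mult[OF u(1)] by simp_all
  have p0: "v $ 0 * r 0 i + v $ 1 * r 1 i + v $ 2 * r 2 i + v $ 3 * A i + v $ 4 * B i = 0" for i
  proof -
    have "v $ 0 * r 0 i + v $ 1 * r 1 i + v $ 2 * r 2 i + v $ 3 * A i + v $ 4 * B i
        = u $ 0 * (var_x ^ 2 * r 0 i + var_x * var_y * r 1 i + var_y ^ 2 * r 2 i)
        - u $ 0 * (var_z * A i + var_w * B i)"
      unfolding vi by (simp add: algebra_simps)
    then show ?thesis unfolding p_eq[symmetric] p_def[symmetric] by simp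
  qed
  have "\<forall>i<6. (d2 *\<^sub>v v) $ i = 0"
    using d2_mult(2)[OF v] unfolding all_less_numerals all_less_3 d2_mult(1,3,4)[OF v] p0
    by (simp add: vi power2_eq_square del: index_mult_mat_vec)
  then have "d2 *\<^sub>v v = 0\<^sub>v 6"
    using d_carrier(3) by (intro eq_vecI) (auto simp del: index_mult_mat_vec)
  then show "v \<in> mat_kernel d2" using v d_carrier(3) by (auto simp: mat_kernel_def)
next
  fix v assume "v \<in> mat_kernel d2"
  then have v: "v \<in> carrier_vec 5" "d2 *\<^sub>v v = 0\<^sub>v 6" using d_carrier(3)
      by (auto simp: mat_kernel_def)
  have "v $ 0 * r 0 i + v $ 1 * r 1 i + v $ 2 * r 2 i + v $ 3 * A i + v $ 4 * B i = 0" if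
      "i < 3" for i
    using d2_mult(2)[OF v(1)] that unfolding v(2) by simp
  moreover have "var_w * v $ 3 - var_z * v $ 4 = 0" "var_y * v $ 1 - var_x * v $ 2 = 0"
      "var_x * v $ 1 - var_y * v $ 0 = 0"
    using d2_mult(1,3,4)[OF v(1)] unfolding v(2) by simp_all
  ultimately obtain u where u: "v $ 0 = var_x ^ 2 * u" "v $ 1 = var_x * var_y * u" "v $ 2
      = var_y ^ 2 * u" "v $ 3 = - (var_z * u)" "v $ 4 = - (var_w * u)"
    using exact_at_F2 by metis
  let ?u = "vec 1 (\<lambda>i. u)"
  have "\<forall>i<5. v $ i = (d3 *\<^sub>v ?u) $ i"
    unfolding all_less_numerals by (simp add: d3_mult u)
  then have "v = d3 *\<^sub>v ?u"
    using v(1) d_carrier(4) by (intro eq_vecI) (auto simp del: index_mult_mat_vec)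
  then show "v \<in> mat_image d3" using d_carrier(4) by (auto simp: mat_image_def)
qed

lemma kernel_d3: "mat_kernel d3 = {0\<^sub>v 1}"
proof (intro equalityI subsetI)
  fix v assume "v \<in> mat_kernel d3"
  then have v: "v \<in> carrier_vec 1" "d3 *\<^sub>v v = 0\<^sub>v 5" using d_carrier(4)
      by (auto simp: mat_kernel_def)
  have "(d3 *\<^sub>v v) $ 3 = - var_z * v $ 0" by (simp add: d3_mult[OF v(1)])
  then have "v $ 0 = 0" unfolding v(2) by simp
  then show "v \<in> {0\<^sub>v 1}" using v(1) by (auto intro!: eq_vecI)
next
  fix v :: "'a R vec" assume "v \<in> {0\<^sub>v 1}"
  then show "v \<in> mat_kernel d3" using d_carrier(4) by (auto simp: mat_kernel_def)
qed

lemma homogeneous_d: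
  "homogeneous_mat [(-2, -1), (-2, -1), (-2, -1)] [(0, 0)] d0"
  "homogeneous_mat [(-6, -1), (-4, -2), (-4, -2), (-4, -2), (-3, -3), (-3, -3)] [(-2, -1), (-2,
      -1), (-2, -1)] d1"
  "homogeneous_mat [(-4, -3), (-4, -3), (-4, -3), (-6, -2), (-6, -2)] [(-6, -1), (-4, -2), (-4,
      -2), (-4, -2), (-3, -3), (-3, -3)] d2"
  "homogeneous_mat [(-6, -3)] [(-4, -3), (-4, -3), (-4, -3), (-6, -2), (-6, -2)] d3"
proof -
  have len: "length [t1, t2, t3] = 3" "length [t1, t2, t3, t4, t5] = 5"
      "length [t1, t2, t3, t4, t5, t6] = 6" "length [t1] = 1"
    for t1 t2 t3 t4 t5 t6 :: "int \<times> int" by simp_all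
  note h = homogeneous_mat_def len all_less_numerals all_less_3
  show "homogeneous_mat [(-2, -1), (-2, -1), (-2, -1)] [(0, 0)] d0"
    unfolding h using d_carrier by (simp add: d0_def R_piece_p)
  show "homogeneous_mat [(-6, -1), (-4, -2), (-4, -2), (-4, -2), (-3, -3), (-3, -3)] [(-2,
      -1), (-2, -1), (-2, -1)] d1"
    unfolding h using d_carrier by (simp add: d1_def R_piece_p R_piece_s R_piece_N1 R_piece_N2
        R_piece_uminus)
  show "homogeneous_mat [(-4, -3), (-4, -3), (-4, -3), (-6, -2), (-6, -2)] [(-6, -1), (-4,
      -2), (-4, -2), (-4, -2), (-3, -3), (-3, -3)] d2"
    unfolding h using d_carrier by (simp add: d2_def R_piece_r R_piece_A R_piece_B R_piece_gens
        R_piece_uminus)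
  have "var_x ^ 2 \<in> R_piece 2 0" "var_x * var_y \<in> R_piece 2 0" "var_y ^ 2 \<in> R_piece 2 0"
    using R_piece_mult[OF R_piece_gens(2,2)] R_piece_mult[OF R_piece_gens(2,3)]
        R_piece_mult[OF R_piece_gens(3,3)]
    by (simp_all add: power2_eq_square)
  then show "homogeneous_mat [(-6, -3)] [(-4, -3), (-4, -3), (-4, -3), (-6, -2), (-6, -2)] d3"
    unfolding h using d_carrier by (simp add: d3_def R_piece_gens R_piece_uminus)
qed

lemma minimal_resolution:
  "minimal_bigraded_free_resolution (ideal_of {p 0, p 1, p 2})
     [[(-2, -1), (-2, -1), (-2, -1)],
      [(-6, -1), (-4, -2), (-4, -2), (-4, -2), (-3, -3), (-3, -3)],
      [(-4, -3), (-4, -3), (-4, -3), (-6, -2), (-6, -2)],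
      [(-6, -3)]] [d0, d1, d2, d3]"
proof -
  have all: "(\<forall>i. Suc i < 4 \<longrightarrow> P i) \<longleftrightarrow> P 0 \<and> P 1 \<and> P 2" for P
  proof -
    have "Suc i < 4 \<longleftrightarrow> i < 3" for i by auto
    then show ?thesis by (simp only: all_less_3)
  qed
  have list4: "length [t1, t2, t3, t4] = 4" "[t1, t2, t3, t4] ! 0 = t1" "[t1, t2, t3, t4] ! 1 = t2"
    "[t1, t2, t3, t4] ! 2 = t3" "[t1, t2, t3, t4] ! Suc 0 = t2" "[t1, t2, t3, t4] ! Suc 1 = t3"
    "[t1, t2, t3, t4] ! Suc 2 = t4" "last [t1, t2, t3, t4] = t4"
    for t1 t2 t3 t4 :: 'b
    by (simp_all add: numeral_2_eq_2 One_nat_def)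
  have one: "length [t] = 1" for t :: "int \<times> int" by simp
  note minimal = homogeneous_d(2-4)[THEN homogeneous_mat_minimal]
  show ?thesis
    unfolding minimal_bigraded_free_resolution_def bigraded_free_resolution_def all list4 one
    by (intro conjI ballI allI impI; (rule homogeneous_d[THEN homogeneous_mat_hom] d0_image
        kernel_d0 kernel_d1 kernel_d2 kernel_d3 list.distinct refl | (rule minimal, simp,
            assumption, assumption)))
qed

end

section \<open>From three forms of bidegree (2, 1) to a pencil of quadrics\<close>

theorem theorem7p9:
  fixes p0 p1 p2 :: "'k::alg_closed_field R"
  assumes "p0 \<in> R_piece 2 1" and "p1 \<in> R_piece 2 1" and "p2 \<in> R_piece 2 1"
    and "no_common_zeros {p0, p1, p2}"
    and "generic_case p0 p1 p2"
  shows "\<exists>ds. minimal_bigraded_free_resolution (ideal_of {p0, p1, p2})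
           [replicate 3 (-2, -1),
            [(-6, -1)] @ replicate 3 (-4, -2) @ replicate 2 (-3, -3),
            replicate 3 (-4, -3) @ replicate 2 (-6, -2),
            [(-6, -3)]] ds"
proof -
  define P where "P j = [p0, p1, p2] ! j" for j
  have P: "P 0 = p0" "P 1 = p1" "P 2 = p2" by (simp_all add: P_def)
  have "\<forall>j<3. \<exists>e g. P j = var_z * (var_x ^ 2 * const (e 0) + var_x * var_y * const (e 1)
      + var_y ^ 2 * const (e (2::nat))) +
         var_w * (var_x ^ 2 * const (g 0) + var_x * var_y * const (g 1)
             + var_y ^ 2 * const (g (2::nat)))"
    unfolding all_less_3 P using R_piece_2_1 assms(1-3) by blast
  then obtain e g where eg: "\<And>j. j < 3 \<Longrightarrow> P j = var_z * (var_x ^ 2 * const (e j 0)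
      + var_x * var_y * const (e j 1) + var_y ^ 2 * const (e j (2::nat))) +
         var_w * (var_x ^ 2 * const (g j 0) + var_x * var_y * const (g j 1)
             + var_y ^ 2 * const (g j (2::nat)))"
    by metis
  \<comment> \<open>The pencil takes the index of the monomial first and that of the form
    second.\<close>
  define a b where "a i j = e j i" and "b i j = g j i" for i j
  have "quadric_pencil.p a b j = P j" if "j < 3" for j
    unfolding eg[OF that] by (simp add: quadric_pencil.p_def quadric_pencil.A_def
        quadric_pencil.B_def a_def b_def)
  then have p: "quadric_pencil.p a b 0 = p0" "quadric_pencil.p a b 1 = p1" "quadric_pencil.p a b 2
      = p2"
    using P by simp_all
  have bpf: "quadric_pencil.base_point_free a b"
    using assms(4) unfolding quadric_pencil.base_point_free_def no_common_zeros_def all_less_3 p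
        by blast
  interpret generic_pencil a b
    by unfold_locales (use bpf quadric_pencil.D_nonzero_if_generic[OF bpf] assms(5)
        in \<open>simp_all add: p\<close>)
  have "replicate 3 t = [t, t, t]" "replicate 2 t = [t, t]" for t :: "int \<times> int"
    by (simp_all add: numeral_2_eq_2 numeral_3_eq_3)
  then show ?thesis using minimal_resolution unfolding p by auto
qed

end
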